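(* For all integers $k>n>0$, $$\beta_k(S_n)=\binom{2n-k}{\lfloor(2n-k)/2\rfloor}\binom{n}{2n-k}+\binom{2n-k+1}{\lfloor(2n-k+1)/2\rfloor}\binom{n}{2n-k+1}.$$
   Context: $S_n$ is the star graph with vertices $V(S_n)=\{1,\dots,n+1\}$ and edges $\{1,2\},\dots,\{1,n+1\}$. For a finite simple graph $G$ on a totally ordered vertex set, $\mathcal C^\bullet(G)$ is the exterior algebra over $\mathbb R$ on generators $x_i^*$ ($i\in V(G)$) and $x_{i,j}^*$ ($\{i,j\}\in E(G)$, $i<j$), all of degree 1, with differential the odd derivation $Q$ such that $Q(x_i^* )=0$ and $Q(x_{i,j}^* )=x_i^*x_j^*$ for $i<j$. $\mathcal C^\bullet(G,V(G))$ is the subcomplex spanned by all monomials $x_{i_1}^*\cdots x_{i_p}^*x_{r_1,s_1}^*\cdots x_{r_q,s_q}^*$ with $i_a\in V(G)$, $\{r_b,s_b\}\in E(G)$ and $\{i_1,\dots,i_p,r_1,s_1,\dots,r_q,s_q\}=V(G)$ as sets (repetitions allowed). Its cohomology is the essential cohomology $\mathcal H^\bullet(G)$ of $G$, and $\beta_k(G)=\dim\mathcal H^k(G)$. Convention: a binomial coefficient with a negative upper or lower entry is $0$. *)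

theory Defs
  imports Complex_Main "HOL-Library.Set_Algebras"
begin

section \<open>Exterior algebras over the reals\<close>

text \<open>
  The exterior algebra on generators of a linearly ordered type, in coordinates with respect to the
  basis of increasing monomials: an element assigns a coefficient to every finite set of generators.
\<close>

typedef 'a ext = "{f :: 'a set \<Rightarrow> real. finite {S. f S \<noteq> 0} \<and> (\<forall>S. infinite S \<longrightarrow> f S = 0)}"
  morphisms coeff Abs_ext
  by (rule exI[of _ "\<lambda>_. 0"]) auto

setup_lifting type_definition_ext

lemma ext_eqI: "(\<And>S. coeff x S = coeff y S) \<Longrightarrow> x = y"
  by transfer auto

lemma finite_supp [simp]: "finite {S. coeff x S \<noteq> 0}"
  by transfer auto

lemma coeff_infinite [simp]: "infinite S \<Longrightarrow> coeff x S = 0"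
  by transfer auto

instantiation ext :: (type) real_vector
begin

lift_definition zero_ext :: "'a ext" is "\<lambda>_. 0"
  by auto

lift_definition plus_ext :: "'a ext \<Rightarrow> 'a ext \<Rightarrow> 'a ext" is "\<lambda>f g S. f S + g S"
  subgoal for f g
    by (auto intro: finite_subset[of _ "{S. f S \<noteq> 0} \<union> {S. g S \<noteq> 0}"])
  done

lift_definition uminus_ext :: "'a ext \<Rightarrow> 'a ext" is "\<lambda>f S. - f S"
  by auto

lift_definition minus_ext :: "'a ext \<Rightarrow> 'a ext \<Rightarrow> 'a ext" is "\<lambda>f g S. f S - g S"
  subgoal for f g
    by (auto intro: finite_subset[of _ "{S. f S \<noteq> 0} \<union> {S. g S \<noteq> 0}"])
  done

lift_definition scaleR_ext :: "real \<Rightarrow> 'a ext \<Rightarrow> 'a ext" is "\<lambda>c f S. c * f S"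
  subgoal for c f
    by (auto intro: finite_subset[of _ "{S. f S \<noteq> 0}"])
  done

instance
  by standard (transfer; auto simp: algebra_simps fun_eq_iff)+

end

lemma coeff_zero [simp]: "coeff 0 S = 0"
  and coeff_add [simp]: "coeff (x + y) S = coeff x S + coeff y S"
  and coeff_uminus [simp]: "coeff (- x) S = - coeff x S"
  and coeff_diff [simp]: "coeff (x - y) S = coeff x S - coeff y S"
  and coeff_scaleR [simp]: "coeff (c *\<^sub>R x) S = c * coeff x S"
  by (transfer; simp)+

lemma coeff_sum [simp]: "coeff (sum f A) S = (\<Sum>a\<in>A. coeff (f a) S)"
  by (induction A rule: infinite_finite_induct) auto

lift_definition basis_ext :: "'a set \<Rightarrow> 'a ext" is
  "\<lambda>A S. if finite A \<and> S = A then 1 else 0"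
  by auto

lemma coeff_basis: "coeff (basis_ext A) S = (if finite A \<and> S = A then 1 else 0)"
  by transfer auto

lemma basis_expansion: "x = (\<Sum>S | coeff x S \<noteq> 0. coeff x S *\<^sub>R basis_ext S)"
proof (rule ext_eqI)
  fix T
  have "coeff (\<Sum>S | coeff x S \<noteq> 0. coeff x S *\<^sub>R basis_ext S) T
      = (\<Sum>S | coeff x S \<noteq> 0. if T = S then coeff x S else 0)"
    unfolding coeff_sum by (rule sum.cong) (auto simp: coeff_basis intro: ccontr)
  also have "\<dots> = coeff x T"
    by (subst sum.delta') auto
  finally show "coeff x T = coeff (\<Sum>S | coeff x S \<noteq> 0. coeff x S *\<^sub>R basis_ext S) T" ..
qed

text \<open>
  The sign of the permutation sorting the concatenation of the increasing words \<open>A\<close> and \<open>B\<close>.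
\<close>

definition shuffle_sign :: "'a::linorder set \<Rightarrow> 'a set \<Rightarrow> real" where
  "shuffle_sign A B = (-1) ^ card {(a, b). a \<in> A \<and> b \<in> B \<and> b < a}"

lemma shuffle_sign_empty [simp]: "shuffle_sign {} B = 1" "shuffle_sign A {} = 1"
  by (auto simp: shuffle_sign_def)

lemma shuffle_sign_Un_left:
  assumes "finite A" "finite B" "finite C" "A \<inter> B = {}"
  shows "shuffle_sign (A \<union> B) C = shuffle_sign A C * shuffle_sign B C"
proof -
  let ?I = "\<lambda>A. {(a, c). a \<in> A \<and> c \<in> C \<and> c < a}"
  have f: "finite (?I D)" if "finite D" for D
    by (rule finite_subset[of _ "D \<times> C"]) (use that assms in auto)
  have "?I (A \<union> B) = ?I A \<union> ?I B" by auto
  moreover have "card (?I A \<union> ?I B) = card (?I A) + card (?I B)"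
    by (rule card_Un_disjoint) (use f assms in auto)
  ultimately show ?thesis
    unfolding shuffle_sign_def by (simp add: power_add)
qed

lemma shuffle_sign_Un_right:
  assumes "finite A" "finite B" "finite C" "B \<inter> C = {}"
  shows "shuffle_sign A (B \<union> C) = shuffle_sign A B * shuffle_sign A C"
proof -
  let ?I = "\<lambda>C. {(a, c). a \<in> A \<and> c \<in> C \<and> c < a}"
  have f: "finite (?I D)" if "finite D" for D
    by (rule finite_subset[of _ "A \<times> D"]) (use that assms in auto)
  have "?I (B \<union> C) = ?I B \<union> ?I C" by auto
  moreover have "card (?I B \<union> ?I C) = card (?I B) + card (?I C)"
    by (rule card_Un_disjoint) (use f assms in auto)
  ultimately show ?thesis
    unfolding shuffle_sign_def by (simp add: power_add)
qed

instantiation ext :: (linorder) real_algebra_1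
begin

lift_definition one_ext :: "'a ext" is "\<lambda>S. if S = {} then 1 else 0"
  by auto

lift_definition times_ext :: "'a ext \<Rightarrow> 'a ext \<Rightarrow> 'a ext" is
  "\<lambda>f g S. \<Sum>A\<in>Pow S. shuffle_sign A (S - A) * f A * g (S - A)"
  subgoal for f g
  proof (intro conjI allI impI)
    assume f: "finite {S. f S \<noteq> 0} \<and> (\<forall>S. infinite S \<longrightarrow> f S = 0)"
      and g: "finite {S. g S \<noteq> 0} \<and> (\<forall>S. infinite S \<longrightarrow> g S = 0)"
    have "{S. (\<Sum>A\<in>Pow S. shuffle_sign A (S - A) * f A * g (S - A)) \<noteq> 0}
        \<subseteq> (\<lambda>(A, B). A \<union> B) ` ({S. f S \<noteq> 0} \<times> {S. g S \<noteq> 0})"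
    proof
      fix S assume "S \<in> {S. (\<Sum>A\<in>Pow S. shuffle_sign A (S - A) * f A * g (S - A)) \<noteq> 0}"
      then obtain A where "A \<subseteq> S" "f A \<noteq> 0" "g (S - A) \<noteq> 0"
        by (auto elim!: sum.not_neutral_contains_not_neutral)
      then show "S \<in> (\<lambda>(A, B). A \<union> B) ` ({S. f S \<noteq> 0} \<times> {S. g S \<noteq> 0})"
        by (intro image_eqI[of _ _ "(A, S - A)"]) auto
    qed
    then show "finite {S. (\<Sum>A\<in>Pow S. shuffle_sign A (S - A) * f A * g (S - A)) \<noteq> 0}"
      by (rule finite_subset) (use f g in auto)
  qed auto
  done

lemma coeff_one: "coeff 1 S = (if S = {} then 1 else 0)"
  by transfer auto

lemma coeff_times:
  "coeff (x * y) S = (\<Sum>A\<in>Pow S. shuffle_sign A (S - A) * coeff x A * coeff y (S - A))"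
  by transfer auto

instance
proof
  fix x y z :: "'a ext" and c :: real
  show "x * y * z = x * (y * z)"
  proof (rule ext_eqI)
    fix S :: "'a set"
    show "coeff (x * y * z) S = coeff (x * (y * z)) S"
    proof (cases "finite S")
      case fin: True
      have "coeff (x * y * z) S = (\<Sum>(T, A)\<in>(SIGMA T:Pow S. Pow T). shuffle_sign T (S - T) *
          (shuffle_sign A (T - A) * coeff x A * coeff y (T - A)) * coeff z (S - T))"
        unfolding coeff_times sum_distrib_left sum_distrib_right
        by (rule sum.Sigma) (use fin in \<open>auto intro: finite_subset\<close>)
      also have "\<dots> = (\<Sum>(A, B)\<in>(SIGMA A:Pow S. Pow (S - A)). shuffle_sign A (S - A) *
          coeff x A * (shuffle_sign B (S - A - B) * coeff y B * coeff z (S - A - B)))"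
      proof (rule sum.reindex_bij_witness[where i = "\<lambda>(A, B). (A \<union> B, A)"
            and j = "\<lambda>(T, A). (A, T - A)"], goal_cases)
        case (5 p)
        then obtain T A where p: "p = (T, A)" "T \<subseteq> S" "A \<subseteq> T" by auto
        define B where "B = T - A"
        define C where "C = S - T"
        have f: "finite A" "finite B" "finite C"
          using p fin by (auto simp: B_def C_def intro: finite_subset)
        have eqs: "T = A \<union> B" "A \<inter> B = {}" "B \<inter> C = {}"
          "T - A = B" "S - T = C" "S - A = B \<union> C" "B \<union> C - B = C"
          using p by (auto simp: B_def C_def)
        have "shuffle_sign T C * shuffle_sign A B = shuffle_sign A (B \<union> C) * shuffle_sign B C"
          using f eqs(2,3) unfolding eqs(1)
          by (simp add: shuffle_sign_Un_left shuffle_sign_Un_right)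
        from arg_cong[OF this, of "\<lambda>t. t * coeff x A * coeff y B * coeff z C"] show ?case
          by (simp only: p prod.case eqs(4-7) mult_ac)
      qed auto
      also have "\<dots> = coeff (x * (y * z)) S"
        unfolding coeff_times sum_distrib_left sum_distrib_right
        by (rule sum.Sigma[symmetric]) (use fin in \<open>auto intro: finite_subset\<close>)
      finally show ?thesis .
    qed simp
  qed
  show "(x + y) * z = x * z + y * z" "x * (y + z) = x * y + x * z"
    by (rule ext_eqI; simp add: coeff_times algebra_simps sum.distrib)+
  show "c *\<^sub>R x * y = c *\<^sub>R (x * y)" "x * c *\<^sub>R y = c *\<^sub>R (x * y)"
    by (rule ext_eqI; simp add: coeff_times algebra_simps sum_distrib_left)+
  show "1 * x = x"
  proof (rule ext_eqI)
    fix S show "coeff (1 * x) S = coeff x S"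
      by (cases "finite S")
        (simp_all add: coeff_times coeff_one if_distrib if_distribR sum.delta cong: if_cong)
  qed
  show "x * 1 = x"
  proof (rule ext_eqI)
    fix S
    have "coeff (x * 1) S = (\<Sum>A\<in>Pow S. if A = S then coeff x S else 0)"
      unfolding coeff_times by (rule sum.cong) (auto simp: coeff_one)
    also have "\<dots> = coeff x S"
      by (cases "finite S") (simp_all add: sum.delta)
    finally show "coeff (x * 1) S = coeff x S" .
  qed
  show "(0 :: 'a ext) \<noteq> 1"
    by (metis coeff_one coeff_zero zero_neq_one)
qed

end

lemma basis_empty: "basis_ext {} = 1"
  by (rule ext_eqI) (simp add: coeff_basis coeff_one)

lemma basis_times_basis:
  assumes "finite A" "finite B"
  shows "basis_ext A * basis_ext B
    = (if A \<inter> B = {} then shuffle_sign A B *\<^sub>R basis_ext (A \<union> B) else 0)"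
proof (rule ext_eqI)
  fix S
  have "coeff (basis_ext A * basis_ext B) S
      = (\<Sum>C\<in>Pow S. if C = A then (if S - A = B then shuffle_sign A B else 0) else 0)"
    unfolding coeff_times by (rule sum.cong) (use assms in \<open>auto simp: coeff_basis\<close>)
  also have "\<dots> = (if finite S \<and> A \<subseteq> S \<and> S - A = B then shuffle_sign A B else 0)"
    by (cases "finite S") (auto simp: sum.delta)
  also have "\<dots> = coeff (if A \<inter> B = {} then shuffle_sign A B *\<^sub>R basis_ext (A \<union> B) else 0) S"
    using assms by (auto simp: coeff_basis)
  finally show "coeff (basis_ext A * basis_ext B) S
    = coeff (if A \<inter> B = {} then shuffle_sign A B *\<^sub>R basis_ext (A \<union> B) else 0) S" .
qed

definition gen :: "'a::linorder \<Rightarrow> 'a ext" where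
  "gen a = basis_ext {a}"

abbreviation monomial :: "'a::linorder list \<Rightarrow> 'a ext" where
  "monomial as \<equiv> prod_list (map gen as)"

lemma gen_square: "gen a * gen a = 0"
  by (simp add: gen_def basis_times_basis)

lemma gen_anticommute: "gen a * gen b = - (gen b * gen a)"
proof -
  have "{(x, y). x \<in> {c} \<and> y \<in> {d} \<and> y < x} = (if d < c then {(c, d)} else {})" for c d :: 'a
    by auto
  then have "shuffle_sign {c} {d} = (if d < c then -1 else 1)" for c d :: 'a
    unfolding shuffle_sign_def by simp
  then show ?thesis
    by (cases a b rule: linorder_cases) (auto simp: gen_def basis_times_basis insert_commute)
qed

lemma gen_square_left: "gen a * (gen a * x) = 0"
  using gen_square[of a] by (simp flip: mult.assoc)

lemma gen_anticommute_left: "gen a * (gen b * x) = - (gen b * (gen a * x))"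
  using gen_anticommute[of a b] by (simp flip: mult.assoc)

lemma gen_times_basis:
  assumes "finite S" "\<And>s. s \<in> S \<Longrightarrow> a < s"
  shows "gen a * basis_ext S = basis_ext (insert a S)"
proof -
  have "{(x, y). x \<in> {a} \<and> y \<in> S \<and> y < x} = {}"
    using assms(2) by force
  then have "shuffle_sign {a} S = 1"
    unfolding shuffle_sign_def by (simp only: card.empty power_0)
  moreover have "a \<notin> S"
    using assms(2) by blast
  ultimately show ?thesis
    by (simp add: gen_def basis_times_basis assms)
qed

lemma basis_eq_monomial:
  "finite S \<Longrightarrow> basis_ext S = monomial (sorted_list_of_set S)"
proof (induction "card S" arbitrary: S)
  case 0
  then show ?case by (simp add: basis_empty)
next
  case (Suc n)
  then have S: "S \<noteq> {}" "finite S" by auto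
  define h where "h = Min S"
  define T where "T = S - {h}"
  have T: "finite T" "n = card T" "S = insert h T"
    using S Suc.hyps(2) by (simp_all add: T_def h_def insert_absorb)
  have hT: "h < t" if "t \<in> T" for t
    using that S by (auto simp: T_def h_def less_le)
  have sl: "sorted_list_of_set S = h # sorted_list_of_set T"
    using S by (simp add: T_def h_def sorted_list_of_set_nonempty)
  have "basis_ext S = gen h * basis_ext T"
    unfolding T(3) using T(1) hT by (simp add: gen_times_basis)
  also have "\<dots> = monomial (sorted_list_of_set S)"
    unfolding sl by (simp add: Suc.hyps(1)[OF T(2,1)])
  finally show ?case .
qed


section \<open>The differential of a graph\<close>

datatype 'v generator = Vertex 'v | Edge 'v 'v

text \<open>
  The linear order on the generators only serves to build the exterior algebra; its choice is
  immaterial.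
\<close>

instantiation generator :: (linorder) linorder
begin

fun less_eq_generator :: "'a generator \<Rightarrow> 'a generator \<Rightarrow> bool" where
  "Vertex i \<le> Vertex j \<longleftrightarrow> i \<le> j"
| "Vertex i \<le> Edge r s \<longleftrightarrow> True"
| "Edge r s \<le> Vertex i \<longleftrightarrow> False"
| "Edge r s \<le> Edge r' s' \<longleftrightarrow> r < r' \<or> r = r' \<and> s \<le> s'"

definition less_generator :: "'a generator \<Rightarrow> 'a generator \<Rightarrow> bool" where
  "less_generator x y \<longleftrightarrow> x \<le> y \<and> \<not> y \<le> x"

instance
proof
  fix x y z :: "'a generator"
  show "x < y \<longleftrightarrow> x \<le> y \<and> \<not> y \<le> x" by (rule less_generator_def)
  show "x \<le> x" by (cases x) auto
  show "x \<le> y \<Longrightarrow> y \<le> z \<Longrightarrow> x \<le> z" by (cases x; cases y; cases z) auto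
  show "x \<le> y \<Longrightarrow> y \<le> x \<Longrightarrow> x = y" by (cases x; cases y) auto
  show "x \<le> y \<or> y \<le> x" by (cases x; cases y) auto
qed

end

fun Q_gen :: "'v::linorder generator \<Rightarrow> 'v generator ext" where
  "Q_gen (Vertex i) = 0"
| "Q_gen (Edge i j) = gen (Vertex i) * gen (Vertex j)"

fun Q_list :: "'v::linorder generator list \<Rightarrow> 'v generator ext" where
  "Q_list [] = 0"
| "Q_list (g # gs) = Q_gen g * monomial gs - gen g * Q_list gs"

text \<open>
  \<open>Q\<close> is the linear extension of the Leibniz rule on the increasing monomials; \<open>Q_monomial_times\<close>
  below shows that it is an odd derivation.
\<close>

definition Q :: "'v::linorder generator ext \<Rightarrow> 'v generator ext" where
  "Q x = (\<Sum>S | coeff x S \<noteq> 0. coeff x S *\<^sub>R Q_list (sorted_list_of_set S))"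

lemma Q_superset:
  assumes "finite F" "{S. coeff x S \<noteq> 0} \<subseteq> F"
  shows "Q x = (\<Sum>S\<in>F. coeff x S *\<^sub>R Q_list (sorted_list_of_set S))"
  unfolding Q_def by (rule sum.mono_neutral_left) (use assms in auto)

lemma linear_Q: "linear Q"
proof (rule linearI)
  fix x y :: "'v::linorder generator ext" and c :: real
  let ?F = "{S. coeff x S \<noteq> 0} \<union> {S. coeff y S \<noteq> 0}"
  have *: "Q z = (\<Sum>S\<in>?F. coeff z S *\<^sub>R Q_list (sorted_list_of_set S))"
    if "{S. coeff z S \<noteq> 0} \<subseteq> ?F" for z
    using that by (intro Q_superset) auto
  have "Q (x + y) = (\<Sum>S\<in>?F. coeff (x + y) S *\<^sub>R Q_list (sorted_list_of_set S))"
    by (rule *) auto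
  also have "\<dots> = Q x + Q y"
    using *[of x] *[of y] by (auto simp: scaleR_left_distrib sum.distrib)
  finally show "Q (x + y) = Q x + Q y" .
  have "Q (c *\<^sub>R x) = (\<Sum>S\<in>?F. coeff (c *\<^sub>R x) S *\<^sub>R Q_list (sorted_list_of_set S))"
    by (rule *) auto
  also have "\<dots> = c *\<^sub>R Q x"
    using *[of x] by (auto simp: scaleR_sum_right)
  finally show "Q (c *\<^sub>R x) = c *\<^sub>R Q x" .
qed

lemma Q_basis: "finite S \<Longrightarrow> Q (basis_ext S) = Q_list (sorted_list_of_set S)"
  by (subst Q_superset[of "{S}"]) (auto simp: coeff_basis split: if_splits)

lemma Q_one [simp]: "Q 1 = 0"
  using Q_basis[of "{}"] by (simp add: basis_empty)

lemma gen_Q_gen_left_commute: "gen g * (Q_gen h * x) = Q_gen h * (gen g * x)"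
proof (cases h)
  case (Edge i j)
  then show ?thesis
    by (simp add: mult.assoc gen_anticommute_left[of g "Vertex i"]
        gen_anticommute_left[of g "Vertex j"])
qed simp

lemma Q_gen_times_basis_aux:
  assumes "finite S" "\<And>s. s \<in> S \<Longrightarrow> g < s"
  shows "Q (gen g * basis_ext S) = Q_gen g * basis_ext S - gen g * Q (basis_ext S)"
proof -
  have "insort g (sorted_list_of_set S) = g # sorted_list_of_set S"
    using assms by (intro insort_is_Cons) (auto intro: less_imp_le)
  moreover have "g \<notin> S"
    using assms(2) by blast
  ultimately have "sorted_list_of_set (insert g S) = g # sorted_list_of_set S"
    using assms(1) by simp
  then have "Q (gen g * basis_ext S) = Q_list (g # sorted_list_of_set S)"
    using assms by (simp add: gen_times_basis Q_basis)
  also have "\<dots> = Q_gen g * basis_ext S - gen g * Q (basis_ext S)"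
    unfolding Q_basis[OF assms(1)] by (simp add: basis_eq_monomial[OF assms(1)])
  finally show ?thesis .
qed

lemma Q_gen_times_basis:
  "finite S \<Longrightarrow> Q (gen g * basis_ext S) = Q_gen g * basis_ext S - gen g * Q (basis_ext S)"
proof (induction "card S" arbitrary: S)
  case 0
  then show ?case by (intro Q_gen_times_basis_aux) auto
next
  case (Suc n)
  then have S: "S \<noteq> {}" "finite S" by auto
  define h where "h = Min S"
  define T where "T = S - {h}"
  have T: "finite T" "n = card T" "S = insert h T"
    using S Suc.hyps(2) by (simp_all add: T_def h_def insert_absorb)
  have hT: "h < t" if "t \<in> T" for t
    using that S by (auto simp: T_def h_def less_le)
  have S_eq: "basis_ext S = gen h * basis_ext T"
    using T hT by (simp add: gen_times_basis)
  have QS: "Q (basis_ext S) = Q_gen h * basis_ext T - gen h * Q (basis_ext T)"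
    unfolding S_eq using T(1) hT by (rule Q_gen_times_basis_aux)
  note IH = Suc.hyps(1)[OF T(2,1)]
  show ?case
  proof (cases g h rule: linorder_cases)
    case less
    then have "g < s" if "s \<in> S" for s using that hT T(3) by force
    with S(2) show ?thesis by (rule Q_gen_times_basis_aux)
  next
    case equal
    have "gen g * basis_ext S = 0"
      by (simp add: S_eq equal gen_square_left)
    moreover have "Q_gen g * basis_ext S = gen g * Q (basis_ext S)"
      unfolding QS unfolding S_eq equal
      by (simp add: right_diff_distrib gen_square_left gen_Q_gen_left_commute)
    ultimately show ?thesis by (simp add: linear_0[OF linear_Q])
  next
    case greater
    have hy: "Q (gen h * (gen g * basis_ext T))
      = Q_gen h * (gen g * basis_ext T) - gen h * Q (gen g * basis_ext T)"
    proof (cases "g \<in> T")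
      case True
      then have "gen g * basis_ext T = 0" by (simp add: gen_def basis_times_basis T(1))
      then show ?thesis by (simp add: linear_0[OF linear_Q])
    next
      case False
      have "finite (insert g T)" "\<And>u. u \<in> insert g T \<Longrightarrow> h < u"
        using T(1) hT greater by auto
      then have "Q (gen h * basis_ext (insert g T))
        = Q_gen h * basis_ext (insert g T) - gen h * Q (basis_ext (insert g T))"
        by (rule Q_gen_times_basis_aux)
      moreover have "gen g * basis_ext T = shuffle_sign {g} T *\<^sub>R basis_ext (insert g T)"
        using False T(1) by (simp add: gen_def basis_times_basis)
      ultimately show ?thesis
        by (simp add: linear_scale[OF linear_Q] scaleR_right_diff_distrib)
    qed
    have "Q (gen g * basis_ext S) = - Q (gen h * (gen g * basis_ext T))"
      by (simp add: S_eq gen_anticommute_left[of g h] linear_neg[OF linear_Q])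
    also have "\<dots> = - (Q_gen h * (gen g * basis_ext T)) + Q_gen g * (gen h * basis_ext T)
        - gen h * (gen g * Q (basis_ext T))"
      by (simp add: hy IH right_diff_distrib gen_Q_gen_left_commute)
    also have "\<dots> = Q_gen g * basis_ext S - gen g * Q (basis_ext S)"
      unfolding QS unfolding S_eq
      by (simp add: right_diff_distrib gen_Q_gen_left_commute gen_anticommute_left[of h g])
    finally show ?thesis .
  qed
qed

lemma Q_gen_times: "Q (gen g * x) = Q_gen g * x - gen g * Q x"
proof -
  define F where "F = {S. coeff x S \<noteq> 0}"
  define y where "y = (\<Sum>S\<in>F. coeff x S *\<^sub>R basis_ext S)"
  have fin: "finite S" if "S \<in> F" for S
    using that coeff_infinite by (auto simp: F_def)
  have Qy: "Q y = (\<Sum>S\<in>F. coeff x S *\<^sub>R Q (basis_ext S))"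
    unfolding y_def by (simp add: linear_sum[OF linear_Q] linear_scale[OF linear_Q])
  have "Q (gen g * y) = (\<Sum>S\<in>F. coeff x S *\<^sub>R Q (gen g * basis_ext S))"
    unfolding y_def
    by (simp add: sum_distrib_left linear_sum[OF linear_Q] linear_scale[OF linear_Q])
  also have "\<dots> = (\<Sum>S\<in>F. Q_gen g * (coeff x S *\<^sub>R basis_ext S)
      - gen g * (coeff x S *\<^sub>R Q (basis_ext S)))"
    by (rule sum.cong) (simp_all add: fin Q_gen_times_basis scaleR_right_diff_distrib)
  also have "\<dots> = Q_gen g * y - gen g * Q y"
    unfolding Qy unfolding y_def by (simp only: sum_distrib_left sum_subtractf)
  finally have "Q (gen g * y) = Q_gen g * y - gen g * Q y" .
  moreover have "y = x"
    unfolding y_def F_def by (rule basis_expansion[symmetric])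
  ultimately show ?thesis by simp
qed

lemma Q_Vertex: "Q (gen (Vertex i)) = 0"
  using Q_gen_times[of "Vertex i" 1] by simp

lemma Q_Edge: "Q (gen (Edge i j)) = gen (Vertex i) * gen (Vertex j)"
  using Q_gen_times[of "Edge i j" 1] by simp

lemma Q_monomial_times:
  "Q (monomial gs * x) = Q (monomial gs) * x + (-1) ^ length gs *\<^sub>R (monomial gs * Q x)"
  by (induction gs) (simp_all add: Q_gen_times algebra_simps)

lemma Q_Q: "Q (Q x) = 0"
proof -
  have QQg: "Q (Q_gen g * y) = Q_gen g * Q y" for g and y :: "'a generator ext"
    by (cases g) (simp_all add: linear_0[OF linear_Q] Q_gen_times mult.assoc)
  have "Q (Q (monomial gs)) = 0" for gs :: "'a generator list"
    by (induction gs)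
      (simp_all add: Q_gen_times linear_diff[OF linear_Q] linear_0[OF linear_Q] QQg)
  then have "Q (Q (basis_ext S)) = 0" if "coeff x S \<noteq> 0" for S
    using that coeff_infinite basis_eq_monomial by metis
  then have "Q (Q (\<Sum>S | coeff x S \<noteq> 0. coeff x S *\<^sub>R basis_ext S)) = 0"
    by (simp add: linear_sum[OF linear_Q] linear_scale[OF linear_Q])
  then show ?thesis
    unfolding basis_expansion[of x, symmetric] .
qed


section \<open>Dimension of a quotient space\<close>

text \<open>
  For subspaces \<open>W \<subseteq> V\<close>, the elements of \<open>V / W\<close> are the cosets \<open>x +o W\<close>. The linear combination
  of cosets \<open>X \<in> T\<close> with coefficients \<open>c X\<close> is formed elementwise; adding \<open>W\<close> makes it a
  coset also if \<open>T\<close> is empty or some coefficients vanish.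
\<close>

definition quotient_space :: "'a::real_vector set \<Rightarrow> 'a set \<Rightarrow> 'a set set" where
  "quotient_space V W = (\<lambda>x. x +o W) ` V"

definition coset_combination ::
  "'a::real_vector set \<Rightarrow> ('a set \<Rightarrow> real) \<Rightarrow> 'a set set \<Rightarrow> 'a set" where
  "coset_combination W c T = W + (\<Sum>X\<in>T. (\<lambda>x. c X *\<^sub>R x) ` X)"

definition quotient_basis :: "'a::real_vector set \<Rightarrow> 'a set \<Rightarrow> 'a set set \<Rightarrow> bool" where
  "quotient_basis V W T \<longleftrightarrow> finite T \<and> T \<subseteq> quotient_space V W \<and>
    (\<forall>c. coset_combination W c T = W \<longrightarrow> (\<forall>X\<in>T. c X = 0)) \<and>
    (\<forall>Y\<in>quotient_space V W. \<exists>c. Y = coset_combination W c T)"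

definition quotient_dim :: "'a::real_vector set \<Rightarrow> 'a set \<Rightarrow> nat" where
  "quotient_dim V W = (if \<exists>T. quotient_basis V W T then card (SOME T. quotient_basis V W T) else 0)"

lemma coset_eq_iff:
  assumes "subspace W"
  shows "x +o W = y +o W \<longleftrightarrow> x - y \<in> W"
proof
  assume "x +o W = y +o W"
  moreover have "x \<in> x +o W"
    using subspace_0[OF assms] by (force simp: elt_set_plus_def)
  ultimately show "x - y \<in> W"
    by (auto simp: elt_set_plus_def)
next
  assume *: "x - y \<in> W"
  have "x + w = y + ((x - y) + w)" "y + w = x + (w - (x - y))" for w
    by (simp_all add: algebra_simps)
  then show "x +o W = y +o W"
    using subspace_add[OF assms *] subspace_diff[OF assms _ *]
    unfolding elt_set_plus_def by blast
qed

lemma coset_combination_reps: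
  assumes W: "subspace W" and "finite T" "\<And>X. X \<in> T \<Longrightarrow> X = r X +o W"
  shows "coset_combination W c T = (\<Sum>X\<in>T. c X *\<^sub>R r X) +o W"
  using assms(2,3) unfolding coset_combination_def
proof (induction T)
  case (insert X T)
  let ?s = "\<Sum>X\<in>T. c X *\<^sub>R r X"
  have "(\<lambda>x. c X *\<^sub>R x) ` X + (?s +o W) = (c X *\<^sub>R r X + ?s) +o W"
  proof (intro set_eqI iffI)
    fix z assume "z \<in> (\<lambda>x. c X *\<^sub>R x) ` X + (?s +o W)"
    then obtain a w where a: "a \<in> X" and w: "w \<in> W" "z = c X *\<^sub>R a + (?s + w)"
      by (auto simp: set_plus_def elt_set_plus_def)
    moreover from a insert.prems[of X] obtain v where "v \<in> W" "a = r X + v"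
      by (auto simp: elt_set_plus_def)
    ultimately have "z = (c X *\<^sub>R r X + ?s) + (c X *\<^sub>R v + w)" "c X *\<^sub>R v + w \<in> W"
      using W by (simp_all add: algebra_simps subspace_add subspace_scale)
    then show "z \<in> (c X *\<^sub>R r X + ?s) +o W"
      by (auto simp: elt_set_plus_def)
  next
    fix z assume "z \<in> (c X *\<^sub>R r X + ?s) +o W"
    then obtain w where w: "w \<in> W" "z = c X *\<^sub>R r X + (?s + w)"
      by (auto simp: elt_set_plus_def add.assoc)
    have "r X \<in> X"
      using insert.prems[of X] subspace_0[OF W] by (force simp: elt_set_plus_def)
    with w show "z \<in> (\<lambda>x. c X *\<^sub>R x) ` X + (?s +o W)"
      by (auto simp: elt_set_plus_def intro: set_plus_intro)
  qed
  moreover have "W + (\<Sum>X\<in>T. (\<lambda>x. c X *\<^sub>R x) ` X) = ?s +o W"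
    using insert by simp
  ultimately show ?case
    by (simp only: sum.insert[OF insert.hyps] add.left_commute[of W])
qed (simp add: set_zero_plus)

lemma quotient_basis_card:
  assumes V: "subspace V" and W: "subspace W" "W \<subseteq> V" and F: "finite F" "V \<subseteq> span F"
    and T: "quotient_basis V W T"
  shows "card T = dim V - dim W"
proof -
  obtain B where B: "B \<subseteq> W" "independent B" "W \<subseteq> span B" "card B = dim W"
    by (rule real_vector.basis_exists)
  have finB: "finite B"
    using real_vector.independent_span_bound[OF F(1) B(2)] B(1) W(2) F(2) by blast
  have finT: "finite T" and TV: "T \<subseteq> quotient_space V W"
    and ind: "\<And>c X. coset_combination W c T = W \<Longrightarrow> X \<in> T \<Longrightarrow> c X = 0"
    and spn: "\<And>Y. Y \<in> quotient_space V W \<Longrightarrow> \<exists>c. Y = coset_combination W c T"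
    using T unfolding quotient_basis_def by blast+
  have "\<forall>X\<in>T. \<exists>x. x \<in> V \<and> X = x +o W"
    using TV by (auto simp: quotient_space_def)
  then obtain r where r: "\<And>X. X \<in> T \<Longrightarrow> r X \<in> V" "\<And>X. X \<in> T \<Longrightarrow> X = r X +o W"
    by metis
  have reps: "coset_combination W c T = (\<Sum>X\<in>T. c X *\<^sub>R r X) +o W" for c
    by (rule coset_combination_reps[OF W(1) finT]) (rule r(2))
  have zero: "c X = 0" if "(\<Sum>X\<in>T. c X *\<^sub>R r X) \<in> W" "X \<in> T" for c X
  proof (rule ind[OF _ that(2)])
    have "(\<Sum>X\<in>T. c X *\<^sub>R r X) +o W = 0 +o W"
      by (subst coset_eq_iff[OF W(1)]) (use that in simp)
    then show "coset_combination W c T = W"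
      unfolding reps by (simp add: set_zero_plus)
  qed
  have inj: "inj_on r T"
    using r(2) by (metis inj_onI)
  have disj: "r ` T \<inter> B = {}"
  proof -
    have False if "X \<in> T" "r X \<in> B" for X
    proof -
      have "(\<Sum>Y\<in>T. (if Y = X then 1 else 0) *\<^sub>R r Y) = (\<Sum>Y\<in>T. if Y = X then r Y else 0)"
        by (rule sum.cong) auto
      also have "\<dots> = r X"
        using that finT by simp
      finally show False
        using zero[of "\<lambda>Y. if Y = X then 1 else 0" X] that B(1) by auto
    qed
    then show ?thesis by blast
  qed
  have "independent (r ` T \<union> B)"
  proof (rule real_vector.independent_if_scalars_zero)
    show "finite (r ` T \<union> B)" using finT finB by simp
    fix f x assume 0: "(\<Sum>x\<in>r ` T \<union> B. f x *\<^sub>R x) = 0" and x: "x \<in> r ` T \<union> B"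
    have eq: "(\<Sum>X\<in>T. f (r X) *\<^sub>R r X) + (\<Sum>x\<in>B. f x *\<^sub>R x) = 0"
      using 0 disj finT finB by (simp add: sum.union_disjoint sum.reindex[OF inj])
    moreover have "(\<Sum>x\<in>B. f x *\<^sub>R x) \<in> W"
      using B(1) W(1) by (intro subspace_sum subspace_scale) auto
    ultimately have "(\<Sum>X\<in>T. f (r X) *\<^sub>R r X) \<in> W"
      using subspace_neg[OF W(1)] by (metis add_eq_0_iff2)
    then have T0: "f (r X) = 0" if "X \<in> T" for X
      using zero[of "\<lambda>X. f (r X)" X] that by simp
    then have "(\<Sum>x\<in>B. f x *\<^sub>R x) = 0"
      using eq by simp
    then have "f b = 0" if "b \<in> B" for b
      using real_vector.independentD[OF B(2) finB subset_refl] that by blast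
    with T0 x show "f x = 0" by auto
  qed
  moreover have "V \<subseteq> span (r ` T \<union> B)"
  proof
    fix v assume "v \<in> V"
    then obtain c where "v +o W = (\<Sum>X\<in>T. c X *\<^sub>R r X) +o W"
      using spn[of "v +o W"] unfolding reps by (auto simp: quotient_space_def)
    then have "v - (\<Sum>X\<in>T. c X *\<^sub>R r X) \<in> W"
      by (simp add: coset_eq_iff[OF W(1)])
    then have "v - (\<Sum>X\<in>T. c X *\<^sub>R r X) \<in> span (r ` T \<union> B)"
      using B(3) span_mono[of B "r ` T \<union> B"] by blast
    moreover have "(\<Sum>X\<in>T. c X *\<^sub>R r X) \<in> span (r ` T \<union> B)"
      by (intro span_sum span_scale span_base) auto
    ultimately show "v \<in> span (r ` T \<union> B)"
      using span_add by fastforce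
  qed
  moreover have "r ` T \<union> B \<subseteq> V"
    using r(1) B(1) W(2) by auto
  ultimately have "dim V = card (r ` T \<union> B)"
    by (intro real_vector.dim_unique) auto
  also have "\<dots> = card T + dim W"
    using card_Un_disjoint[of "r ` T" B] disj finT finB B(4) by (simp add: card_image[OF inj])
  finally show ?thesis by simp
qed

lemma quotient_basis_exists:
  assumes V: "subspace V" and W: "subspace W" "W \<subseteq> V" and F: "finite F" "V \<subseteq> span F"
  shows "\<exists>T. quotient_basis V W T"
proof -
  obtain B where B: "B \<subseteq> W" "independent B" "W \<subseteq> span B"
    by (rule real_vector.basis_exists)
  obtain C where C: "B \<subseteq> C" "C \<subseteq> V" "independent C" "V \<subseteq> span C"
    using real_vector.maximal_independent_subset_extend[of B V] B W(2) by blast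
  have finC: "finite C"
    using real_vector.independent_span_bound[OF F(1) C(3)] C(2) F(2) by blast
  have nospan: "x \<notin> span (C - {x})" if "x \<in> C" for x
    using C(3) that unfolding real_vector.dependent_def by blast
  have Wspan: "W \<subseteq> span (C - {x})" if "x \<in> C - B" for x
    using B(3) span_mono[of B "C - {x}"] C(1) that by blast
  define q where "q = (\<lambda>x. x +o W)"
  have inj: "inj_on q (C - B)"
  proof (rule inj_onI, rule ccontr)
    fix x y assume xy: "x \<in> C - B" "y \<in> C - B" "q x = q y" "x \<noteq> y"
    then have "x - y \<in> span (C - {x})"
      using Wspan coset_eq_iff[OF W(1)] by (auto simp: q_def)
    moreover have "y \<in> span (C - {x})"
      using xy by (intro span_base) auto
    ultimately show False
      using nospan[of x] xy(1) span_add by fastforce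
  qed
  define T where "T = q ` (C - B)"
  have finT: "finite T" using finC by (simp add: T_def)
  have reps: "coset_combination W c T = (\<Sum>x\<in>C - B. c (q x) *\<^sub>R x) +o W" for c
  proof -
    have "X = the_inv_into (C - B) q X +o W" if "X \<in> T" for X
    proof -
      from that obtain x where x: "x \<in> C - B" "X = q x" unfolding T_def by blast
      then have "the_inv_into (C - B) q X = x" by (simp add: the_inv_into_f_f[OF inj])
      with x(2) show ?thesis by (simp add: q_def)
    qed
    then have "coset_combination W c T = (\<Sum>X\<in>T. c X *\<^sub>R the_inv_into (C - B) q X) +o W"
      by (rule coset_combination_reps[OF W(1) finT])
    also have "(\<Sum>X\<in>T. c X *\<^sub>R the_inv_into (C - B) q X) = (\<Sum>x\<in>C - B. c (q x) *\<^sub>R x)"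
      unfolding T_def by (simp add: sum.reindex[OF inj] the_inv_into_f_f[OF inj])
    finally show ?thesis .
  qed
  have "c X = 0" if eq: "coset_combination W c T = W" and X: "X \<in> T" for c X
  proof (rule ccontr)
    assume nz: "c X \<noteq> 0"
    obtain x where x: "x \<in> C - B" "X = q x" using X by (auto simp: T_def)
    have "(\<Sum>x\<in>C - B. c (q x) *\<^sub>R x) +o W = 0 +o W"
      using eq by (simp add: reps set_zero_plus)
    then have "(\<Sum>x\<in>C - B. c (q x) *\<^sub>R x) \<in> W"
      by (simp only: coset_eq_iff[OF W(1)] diff_zero)
    then have "(\<Sum>x\<in>C - B. c (q x) *\<^sub>R x) \<in> span (C - {x})"
      using Wspan[OF x(1)] by blast
    moreover have "(\<Sum>x\<in>C - B. c (q x) *\<^sub>R x) = c X *\<^sub>R x + (\<Sum>y\<in>C - B - {x}. c (q y) *\<^sub>R y)"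
      using finC x by (simp add: sum.remove)
    moreover have "(\<Sum>y\<in>C - B - {x}. c (q y) *\<^sub>R y) \<in> span (C - {x})"
      by (intro span_sum span_scale span_base) auto
    ultimately have "c X *\<^sub>R x \<in> span (C - {x})"
      using span_diff by fastforce
    then have "x \<in> span (C - {x})"
      using nz span_scale[of "c X *\<^sub>R x" "C - {x}" "inverse (c X)"] by simp
    then show False
      using nospan x(1) by blast
  qed
  moreover have "\<exists>c. Y = coset_combination W c T" if "Y \<in> quotient_space V W" for Y
  proof -
    from that obtain v where v: "v \<in> V" "Y = v +o W"
      unfolding quotient_space_def by blast
    then obtain u where u: "v = (\<Sum>x\<in>C. u x *\<^sub>R x)"
      using C(4) real_vector.span_finite[OF finC] by auto
    have "(\<Sum>x\<in>C. u x *\<^sub>R x) = (\<Sum>x\<in>B. u x *\<^sub>R x) + (\<Sum>x\<in>C - B. u x *\<^sub>R x)"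
      using sum.subset_diff[OF C(1) finC, of "\<lambda>x. u x *\<^sub>R x"] by (simp add: add.commute)
    moreover have "(\<Sum>x\<in>B. u x *\<^sub>R x) \<in> W"
      using B(1) W(1) by (intro subspace_sum subspace_scale) auto
    ultimately have "v +o W = (\<Sum>x\<in>C - B. u x *\<^sub>R x) +o W"
      by (simp add: coset_eq_iff[OF W(1)] u)
    moreover have "(\<Sum>x\<in>C - B. u (the_inv_into (C - B) q (q x)) *\<^sub>R x) = (\<Sum>x\<in>C - B. u x *\<^sub>R x)"
      by (rule sum.cong) (simp_all add: the_inv_into_f_f[OF inj])
    ultimately show ?thesis
      unfolding reps v(2) by (intro exI[of _ "\<lambda>X. u (the_inv_into (C - B) q X)"]) simp
  qed
  moreover have "T \<subseteq> quotient_space V W"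
    using C(2) by (auto simp: T_def q_def quotient_space_def)
  ultimately show ?thesis
    using finT unfolding quotient_basis_def by blast
qed

lemma quotient_dim_eq:
  assumes "subspace V" "subspace W" "W \<subseteq> V" "finite F" "V \<subseteq> span F"
  shows "quotient_dim V W = dim V - dim W"
proof -
  have ex: "\<exists>T. quotient_basis V W T"
    using assms by (rule quotient_basis_exists)
  then have "quotient_basis V W (SOME T. quotient_basis V W T)"
    by (rule someI_ex)
  then show ?thesis
    unfolding quotient_dim_def using ex quotient_basis_card[OF assms] by simp
qed


section \<open>Essential cohomology of graphs\<close>

record 'v graph =
  verts :: "'v set"
  edges :: "'v set set"

definition simple_graph :: "'v graph \<Rightarrow> bool" where
  "simple_graph G \<longleftrightarrow> finite (verts G) \<and> (\<forall>e\<in>edges G. e \<subseteq> verts G \<and> card e = 2)"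

definition edge_pairs :: "'v::linorder graph \<Rightarrow> ('v \<times> 'v) set" where
  "edge_pairs G = {(r, s). r < s \<and> {r, s} \<in> edges G}"

text \<open>
  All graphs on \<open>'v\<close> share the ambient exterior algebra on all \<open>Vertex i\<close> and \<open>Edge r s\<close>; the
  generators belonging to \<open>G\<close> are those with \<open>i \<in> verts G\<close> and \<open>(r, s) \<in> edge_pairs G\<close>.
  Every generator has degree 1, so the degree of a monomial is its length. Generators may repeat
  in the lists below, but then the monomial is zero.
\<close>

definition ess_cochains :: "'v::linorder graph \<Rightarrow> nat \<Rightarrow> 'v generator ext set" where
  "ess_cochains G k = span {monomial (map Vertex is) * monomial (map (\<lambda>(r, s). Edge r s) es) | is es.
     set is \<subseteq> verts G \<and> set es \<subseteq> edge_pairs G \<and>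
     set is \<union> (\<Union>(r, s)\<in>set es. {r, s}) = verts G \<and> length is + length es = k}"

definition ess_cocycles :: "'v::linorder graph \<Rightarrow> nat \<Rightarrow> 'v generator ext set" where
  "ess_cocycles G k = {x \<in> ess_cochains G k. Q x = 0}"

definition ess_coboundaries :: "'v::linorder graph \<Rightarrow> nat \<Rightarrow> 'v generator ext set" where
  "ess_coboundaries G k = (if k = 0 then {0} else Q ` ess_cochains G (k - 1))"

definition betti :: "'v::linorder graph \<Rightarrow> nat \<Rightarrow> nat" where
  "betti G k = quotient_dim (ess_cocycles G k) (ess_coboundaries G k)"

definition star_graph :: "nat \<Rightarrow> nat graph" where
  "star_graph n = \<lparr>verts = {1..n + 1}, edges = {{1, j} | j. j \<in> {2..n + 1}}\<rparr>"

lemma simple_star_graph: "simple_graph (star_graph n)"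
  by (auto simp: simple_graph_def star_graph_def)

text \<open>The order of the factors in the spanning monomials is immaterial.\<close>

fun gen_verts :: "'v generator \<Rightarrow> 'v set" where
  "gen_verts (Vertex i) = {i}"
| "gen_verts (Edge r s) = {r, s}"

definition graph_gens :: "'v::linorder graph \<Rightarrow> 'v generator set" where
  "graph_gens G = Vertex ` verts G \<union> (\<lambda>(r, s). Edge r s) ` edge_pairs G"

lemma gen_times_monomial:
  "gen g * monomial hs = (-1) ^ length hs *\<^sub>R (monomial hs * gen g)"
proof (induction hs)
  case (Cons h hs)
  have "gen g * monomial (h # hs) = - (gen h * (gen g * monomial hs))"
    by (simp add: gen_anticommute_left[of g h])
  then show ?case
    by (simp add: Cons.IH mult.assoc)
qed simp

lemma monomial_reorder:
  "\<exists>is es c. monomial gs = c *\<^sub>R (monomial (map Vertex is) * monomial (map (\<lambda>(r, s). Edge r s) es)) \<and>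
    set gs = Vertex ` set is \<union> (\<lambda>(r, s). Edge r s) ` set es \<and> length gs = length is + length es"
proof (induction gs)
  case Nil
  show ?case by (rule exI[of _ "[]"], rule exI[of _ "[]"], rule exI[of _ 1]) simp
next
  case (Cons g gs)
  then obtain "is" es c where IH:
    "monomial gs = c *\<^sub>R (monomial (map Vertex is) * monomial (map (\<lambda>(r, s). Edge r s) es))"
    "set gs = Vertex ` set is \<union> (\<lambda>(r, s). Edge r s) ` set es" "length gs = length is + length es"
    by blast
  show ?case
  proof (cases g)
    case (Vertex i)
    show ?thesis
      by (rule exI[of _ "i # is"], rule exI[of _ es], rule exI[of _ c])
        (simp add: IH Vertex mult.assoc)
  next
    case (Edge r s)
    have "monomial (g # gs) = c *\<^sub>R (gen g * monomial (map Vertex is)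
        * monomial (map (\<lambda>(r, s). Edge r s) es))"
      by (simp add: IH mult.assoc)
    also have "\<dots> = (c * (-1) ^ length is) *\<^sub>R (monomial (map Vertex is)
        * monomial (map (\<lambda>(r, s). Edge r s) ((r, s) # es)))"
      unfolding gen_times_monomial by (simp add: Edge mult.assoc)
    finally show ?thesis
      by (intro exI[of _ "is"] exI[of _ "(r, s) # es"] exI[of _ "c * (-1) ^ length is"])
        (simp add: IH Edge)
  qed
qed

lemma ess_cochains_eq:
  "ess_cochains G k = span {monomial gs | gs. set gs \<subseteq> graph_gens G \<and>
     (\<Union>g\<in>set gs. gen_verts g) = verts G \<and> length gs = k}" (is "_ = span ?M")
proof (rule antisym)
  show "ess_cochains G k \<subseteq> span ?M"
    unfolding ess_cochains_def
  proof (rule span_mono, clarify)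
    fix "is" and es :: "('a \<times> 'a) list"
    assume "set is \<subseteq> verts G" "set es \<subseteq> edge_pairs G"
      "set is \<union> (\<Union>(r, s)\<in>set es. {r, s}) = verts G" "k = length is + length es"
    then show "\<exists>gs. monomial (map Vertex is) * monomial (map (\<lambda>(r, s). Edge r s) es) = monomial gs \<and>
        set gs \<subseteq> graph_gens G \<and> (\<Union>g\<in>set gs. gen_verts g) = verts G \<and>
        length gs = length is + length es"
      by (intro exI[of _ "map Vertex is @ map (\<lambda>(r, s). Edge r s) es"])
        (auto simp: graph_gens_def case_prod_unfold)
  qed
  show "span ?M \<subseteq> ess_cochains G k"
  proof (rule span_minimal)
    show "subspace (ess_cochains G k)"
      unfolding ess_cochains_def by (rule subspace_span)
    show "?M \<subseteq> ess_cochains G k"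
    proof clarify
      fix gs assume gs: "set gs \<subseteq> graph_gens G" "(\<Union>g\<in>set gs. gen_verts g) = verts G" "k = length gs"
      obtain "is" es c where re:
        "monomial gs = c *\<^sub>R (monomial (map Vertex is) * monomial (map (\<lambda>(r, s). Edge r s) es))"
        "set gs = Vertex ` set is \<union> (\<lambda>(r, s). Edge r s) ` set es" "length gs = length is + length es"
        using monomial_reorder[of gs] by blast
      have "set is \<subseteq> verts G" "set es \<subseteq> edge_pairs G"
        using gs(1) unfolding re(2) graph_gens_def by auto
      moreover have "set is \<union> (\<Union>(r, s)\<in>set es. {r, s}) = verts G"
        using gs(2) unfolding re(2) by (auto simp: case_prod_unfold)
      ultimately show "monomial gs \<in> ess_cochains G (length gs)"
        unfolding re(1,3) ess_cochains_def by (intro span_scale span_base) blast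
    qed
  qed
qed

lemma Q_monomial_in_span:
  assumes G: "simple_graph G" and "set gs \<subseteq> graph_gens G"
  shows "Q (monomial gs) \<in> span {monomial hs | hs. set hs \<subseteq> graph_gens G \<and>
    (\<Union>g\<in>set hs. gen_verts g) = (\<Union>g\<in>set gs. gen_verts g) \<and> length hs = Suc (length gs)}"
  (is "_ \<in> span (?M gs)")
  using assms(2)
proof (induction gs)
  case (Cons g gs)
  have "gen g * y \<in> span (?M (g # gs))" if "y \<in> span (?M gs)" for y
    using that
  proof (induction rule: real_vector.span_induct_alt)
    case (step c x y)
    then obtain hs where "x = monomial hs" "set hs \<subseteq> graph_gens G"
      "(\<Union>g\<in>set hs. gen_verts g) = (\<Union>g\<in>set gs. gen_verts g)" "length hs = Suc (length gs)"
      by blast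
    then have "gen g * x \<in> ?M (g # gs)"
      using Cons.prems by (intro CollectI exI[of _ "g # hs"]) simp
    then show ?case
      using step by (simp add: distrib_left span_add span_scale span_base)
  qed (simp add: span_zero)
  then have "gen g * Q (monomial gs) \<in> span (?M (g # gs))"
    using Cons by simp
  moreover have "Q_gen g * monomial gs \<in> span (?M (g # gs))"
  proof (cases g)
    case (Edge r s)
    then have "{r, s} \<in> edges G"
      using Cons.prems by (auto simp: graph_gens_def edge_pairs_def)
    then have "{r, s} \<subseteq> verts G"
      using G unfolding simple_graph_def by blast
    then have "Q_gen g * monomial gs \<in> ?M (g # gs)"
      using Cons.prems
      by (intro CollectI exI[of _ "Vertex r # Vertex s # gs"])
        (auto simp: Edge graph_gens_def mult.assoc)
    then show ?thesis by (rule span_base)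
  qed (simp add: span_zero)
  ultimately show ?case
    by (simp add: Q_gen_times span_diff)
qed (simp add: span_zero)

lemma Q_ess_cochains:
  assumes G: "simple_graph G" and "x \<in> ess_cochains G k"
  shows "Q x \<in> ess_cochains G (Suc k)"
  using assms(2) unfolding ess_cochains_eq[of G k]
proof (induction rule: real_vector.span_induct_alt)
  case base
  show ?case
    by (simp add: linear_0[OF linear_Q] ess_cochains_def span_zero)
next
  case (step c x y)
  then obtain gs where "x = monomial gs" "set gs \<subseteq> graph_gens G"
    "(\<Union>g\<in>set gs. gen_verts g) = verts G" "length gs = k"
    by blast
  then have "Q x \<in> ess_cochains G (Suc k)"
    using Q_monomial_in_span[OF G, of gs] unfolding ess_cochains_eq by simp
  with step show ?case
    unfolding ess_cochains_def
    by (simp add: linear_add[OF linear_Q] linear_scale[OF linear_Q] span_add span_scale)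
qed

lemma betti_eq_dim_diff:
  assumes G: "simple_graph G"
  shows "betti G k = dim (ess_cocycles G k) - dim (ess_coboundaries G k)"
  unfolding betti_def
proof (rule quotient_dim_eq)
  have C: "subspace (ess_cochains G j)" for j
    unfolding ess_cochains_def by (rule subspace_span)
  show "subspace (ess_cocycles G k)"
    unfolding ess_cocycles_def
    using real_vector.subspace_inter[OF C linear_subspace_kernel[OF linear_Q]]
    by (simp add: Int_def)
  show "subspace (ess_coboundaries G k)"
    unfolding ess_coboundaries_def
    by (auto intro: linear_subspace_image[OF linear_Q] C)
  show "ess_coboundaries G k \<subseteq> ess_cocycles G k"
    using C[of 0] Q_ess_cochains[OF G, of _ "k - 1"]
    by (auto simp: ess_coboundaries_def ess_cocycles_def Q_Q linear_0[OF linear_Q] subspace_0)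
  let ?L = "{gs. set gs \<subseteq> graph_gens G \<and> length gs = k}"
  have "finite (edge_pairs G)"
    by (rule finite_subset[of _ "verts G \<times> verts G"])
      (use G in \<open>auto simp: edge_pairs_def simple_graph_def\<close>)
  then show "finite (monomial ` ?L)"
    using G by (intro finite_imageI finite_lists_length_eq) (auto simp: graph_gens_def simple_graph_def)
  have "ess_cochains G k \<subseteq> span (monomial ` ?L)"
    unfolding ess_cochains_eq by (rule span_mono) auto
  then show "ess_cocycles G k \<subseteq> span (monomial ` ?L)"
    by (auto simp: ess_cocycles_def)
qed


section \<open>Binomial coefficients with integer entries\<close>

definition binom :: "int \<Rightarrow> int \<Rightarrow> nat" where
  "binom a b = (if a < 0 \<or> b < 0 then 0 else nat a choose nat b)"

end

theory Submission
  imports Defs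
begin

text \<open>
  Write \<open>c\<close> for the generator of the centre, and \<open>x\<^sub>j\<close>, \<open>y\<^sub>j\<close> for the generators of the leaf \<open>j\<close> and
  its edge. In degree \<open>k > n\<close> the essential cochains are \<open>c \<cdot> W\<^sub>k\<^sub>-\<^sub>1 + W\<^sub>k\<close>, where \<open>W\<close> is the tensor product
  over the leaves of the spans of \<open>x\<^sub>j\<close>, \<open>y\<^sub>j\<close>, \<open>x\<^sub>j y\<^sub>j\<close>. On \<open>W\<close> the differential is \<open>Q w = c \<cdot> D w\<close>
  with the even derivation \<open>D\<close> given by \<open>y\<^sub>j \<mapsto> x\<^sub>j \<mapsto> 0\<close>, so that by rank-nullity the Betti
  number is the sum of the dimensions of the kernels of \<open>D\<close> on \<open>W\<^sub>k\<close> and on \<open>W\<^sub>k\<^sub>-\<^sub>1\<close>. Each factor of \<open>W\<close> is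
  the two-dimensional representation of \<open>sl\<^sub>2\<close> plus a trivial one, with \<open>D\<close> as raising operator. The
  kernel dimensions follow by adding one leaf at a time, for all powers of \<open>D\<close> simultaneously.
\<close>

section \<open>Dimension of subspaces\<close>

text \<open>\<open>dim\<close> gives a number for every set; this predicate also records that
  \<open>V\<close> is a finite-dimensional subspace.\<close>

definition has_dim :: "'a::real_vector set \<Rightarrow> nat \<Rightarrow> bool" where
  "has_dim V d \<longleftrightarrow> (\<exists>B. finite B \<and> independent B \<and> span B = V \<and> card B = d)"

lemma has_dim_imp_dim: "has_dim V d \<Longrightarrow> dim V = d"
  unfolding has_dim_def by (metis real_vector.dim_span_eq_card_independent)

lemma has_dim_imp_subspace: "has_dim V d \<Longrightarrow> subspace V"
  unfolding has_dim_def by (metis subspace_span)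

lemma has_dim_zero: "has_dim {0} 0"
  unfolding has_dim_def by (intro exI[of _ "{}"]) (simp add: real_vector.independent_empty)

lemma has_dim_span_singleton: "v \<noteq> 0 \<Longrightarrow> has_dim (span {v}) 1"
  unfolding has_dim_def by (intro exI[of _ "{v}"]) simp

lemma has_dim_image:
  assumes f: "linear f" "inj_on f V" and "has_dim V d"
  shows "has_dim (f ` V) d"
proof -
  obtain B where B: "finite B" "independent B" "span B = V" "card B = d"
    using assms(3) unfolding has_dim_def by blast
  have "B \<subseteq> V"
    using B(3) by (auto intro: span_base)
  then have "card (f ` B) = d"
    using B(4) f(2) by (metis card_image inj_on_subset)
  then show ?thesis
    unfolding has_dim_def
    using B f linear_independent_injective_image[OF f(1) B(2)] linear_span_image[OF f(1), of B]
    by (intro exI[of _ "f ` B"]) auto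
qed

lemma has_dim_direct_sum:
  assumes V: "has_dim V d" and W: "has_dim W e" and VW: "V \<inter> W \<subseteq> {0}"
  shows "has_dim (V + W) (d + e)"
proof -
  obtain B where B: "finite B" "independent B" "span B = V" "card B = d"
    using V unfolding has_dim_def by blast
  obtain C where C: "finite C" "independent C" "span C = W" "card C = e"
    using W unfolding has_dim_def by blast
  have "B \<inter> C \<subseteq> {0}"
    using VW B(3) C(3) by (auto dest: span_base)
  moreover have "0 \<notin> B"
    using B(2) real_vector.dependent_zero by blast
  ultimately have disj: "B \<inter> C = {}"
    by blast
  have "independent (B \<union> C)"
  proof (rule real_vector.independent_if_scalars_zero)
    show "finite (B \<union> C)" using B C by simp
    fix f x assume 0: "(\<Sum>x\<in>B \<union> C. f x *\<^sub>R x) = 0" and x: "x \<in> B \<union> C"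
    have eq: "(\<Sum>x\<in>B. f x *\<^sub>R x) + (\<Sum>x\<in>C. f x *\<^sub>R x) = 0"
      using 0 disj B(1) C(1) by (simp add: sum.union_disjoint)
    have sB: "(\<Sum>x\<in>B. f x *\<^sub>R x) \<in> V" and sC: "(\<Sum>x\<in>C. f x *\<^sub>R x) \<in> W"
      unfolding B(3)[symmetric] C(3)[symmetric] by (intro span_sum span_scale span_base; simp)+
    have "- (\<Sum>x\<in>C. f x *\<^sub>R x) \<in> W"
      using sC subspace_neg has_dim_imp_subspace[OF W] by blast
    then have "(\<Sum>x\<in>B. f x *\<^sub>R x) \<in> W"
      using eq by (simp add: eq_neg_iff_add_eq_0[symmetric])
    then have zB: "(\<Sum>x\<in>B. f x *\<^sub>R x) = 0"
      using sB VW by blast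
    then have zC: "(\<Sum>x\<in>C. f x *\<^sub>R x) = 0"
      using eq by simp
    show "f x = 0"
      using x real_vector.independentD[OF B(2,1) subset_refl zB]
        real_vector.independentD[OF C(2,1) subset_refl zC] by blast
  qed
  moreover have "span (B \<union> C) = V + W"
    unfolding real_vector.span_Un B(3) C(3) by (auto simp: set_plus_def)
  moreover have "card (B \<union> C) = d + e"
    using disj B C by (simp add: card_Un_disjoint)
  ultimately show ?thesis
    unfolding has_dim_def using B(1) C(1) by blast
qed

text \<open>A basis \<open>B\<close> of the kernel extends to a basis \<open>C\<close> of
  \<open>V\<close>, and \<open>f\<close> is injective on the span of \<open>C - B\<close>, with the
  same image.\<close>

lemma has_dim_rank_nullity:
  assumes V: "has_dim V d" and f: "linear f" and K: "has_dim {v \<in> V. f v = 0} e"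
  shows "\<exists>i. has_dim (f ` V) i \<and> d = e + i"
proof -
  let ?K = "{v \<in> V. f v = 0}"
  obtain F where F: "finite F" "span F = V"
    using V unfolding has_dim_def by blast
  obtain B where B: "finite B" "independent B" "span B = ?K" "card B = e"
    using K unfolding has_dim_def by blast
  have BV: "B \<subseteq> V"
    using B(3) span_base by blast
  obtain C where C: "B \<subseteq> C" "C \<subseteq> V" "independent C" "V \<subseteq> span C"
    using real_vector.maximal_independent_subset_extend[OF BV B(2)] by blast
  have finC: "finite C"
    using real_vector.independent_span_bound[OF F(1) C(3)] C(2) F(2) by blast
  have spanC: "span C = V"
    using C(2,4) span_minimal[OF C(2) has_dim_imp_subspace[OF V]] by blast
  have cardC: "card C = d"
    using has_dim_imp_dim[OF V] real_vector.dim_span_eq_card_independent[OF C(3)] spanC by simp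
  have "inj_on f (span (C - B))"
    unfolding linear_injective_on_subspace_0[OF f subspace_span]
  proof (intro ballI impI)
    fix v assume v: "v \<in> span (C - B)" "f v = 0"
    then have "v \<in> span B"
      using B(3) spanC span_mono[of "C - B" C] by blast
    then obtain p where p: "v = (\<Sum>x\<in>B. p x *\<^sub>R x)"
      using real_vector.span_finite[OF B(1)] by auto
    obtain q where q: "v = (\<Sum>x\<in>C - B. q x *\<^sub>R x)"
      using v(1) real_vector.span_finite[of "C - B"] finC by auto
    define h where "h x = (if x \<in> B then p x else - q x)" for x
    have "(\<Sum>x\<in>C. h x *\<^sub>R x) = (\<Sum>x\<in>C - B. h x *\<^sub>R x) + (\<Sum>x\<in>B. h x *\<^sub>R x)"
      using sum.subset_diff[OF C(1) finC] .
    also have "(\<Sum>x\<in>C - B. h x *\<^sub>R x) = - v"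
      unfolding q by (simp add: h_def sum_negf[symmetric])
    also have "(\<Sum>x\<in>B. h x *\<^sub>R x) = v"
      unfolding p by (simp add: h_def)
    finally have "(\<Sum>x\<in>C. h x *\<^sub>R x) = 0"
      by simp
    then have "h x = 0" if "x \<in> B" for x
      using real_vector.independentD[OF C(3) finC subset_refl] that C(1) by blast
    then have "p x = 0" if "x \<in> B" for x
      using that by (metis h_def)
    then show "v = 0"
      unfolding p by simp
  qed
  moreover have "has_dim (span (C - B)) (d - e)"
    unfolding has_dim_def
    using finC C(1) cardC B(1,4) real_vector.independent_mono[OF C(3), of "C - B"]
    by (intro exI[of _ "C - B"]) (auto simp: card_Diff_subset)
  ultimately have "has_dim (f ` span (C - B)) (d - e)"
    using has_dim_image[OF f] by blast
  moreover have "f ` V = f ` span (C - B)"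
  proof -
    have "f ` V = span (f ` C)"
      using linear_span_image[OF f, of C] spanC by simp
    also have "f ` C = f ` (C - B) \<union> f ` B"
      using C(1) by blast
    also have "span (f ` (C - B) \<union> f ` B) = span (f ` (C - B))"
    proof -
      have "f x = 0" if "x \<in> B" for x
        using span_base[OF that] B(3) by blast
      then have "f ` B \<subseteq> span (f ` (C - B))"
        using span_zero by (metis image_subsetI)
      then show ?thesis
        by (intro antisym span_minimal subspace_span span_mono) (auto intro: span_base)
    qed
    finally show ?thesis
      using linear_span_image[OF f] by simp
  qed
  moreover have "e \<le> d"
    using card_mono[OF finC C(1)] cardC B(4) by simp
  ultimately show ?thesis
    by (intro exI[of _ "d - e"]) simp
qed


section \<open>Kernels of the powers of a nilpotent operator\<close>

definition ker_pow :: "('a::real_vector \<Rightarrow> 'a) \<Rightarrow> nat \<Rightarrow> 'a set \<Rightarrow> 'a set" where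
  "ker_pow D r U = {u \<in> U. (D ^^ r) u = 0}"

lemma linear_funpow:
  assumes "linear (D :: 'a::real_vector \<Rightarrow> 'a)"
  shows "linear (D ^^ r)"
proof (induction r)
  case 0
  show ?case using linear_id by (simp add: id_def)
next
  case (Suc r)
  then show ?case using linear_compose[OF Suc assms] by (simp add: o_def)
qed

lemma ker_pow_0: "subspace U \<Longrightarrow> ker_pow D 0 U = {0}"
  by (auto simp: ker_pow_def subspace_0)

text \<open>
  With \<open>D x = 0\<close> and \<open>D y = x\<close>, the span of \<open>x\<close> and \<open>y\<close> is the two-dimensional
  representation of \<open>sl\<^sub>2\<close>, and \<open>X\<close> and \<open>Y\<close> tensor with \<open>x\<close> and \<open>y\<close>; the dimension count is
  the Clebsch--Gordan rule. On the element \<open>X a - Y (D a) / (r + 1)\<close>, the operator \<open>D ^^ (r + 1)\<close>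
  takes the value \<open>- Y ((D ^^ (r + 2)) a) / (r + 1)\<close>.
\<close>

lemma has_dim_ker_pow_step:
  fixes D X Y Z :: "'a::real_vector \<Rightarrow> 'a"
  assumes lin: "linear D" "linear X" "linear Y" "linear Z"
    and U: "subspace U" "\<And>u. u \<in> U \<Longrightarrow> D u \<in> U"
    and U': "subspace U'" "\<And>u. u \<in> U' \<Longrightarrow> D u \<in> U'"
    and DX: "\<And>u. u \<in> U \<Longrightarrow> D (X u) = X (D u)"
    and DY: "\<And>u. u \<in> U \<Longrightarrow> D (Y u) = X u + Y (D u)"
    and DZ: "\<And>u. u \<in> U' \<Longrightarrow> D (Z u) = Z (D u)"
    and direct: "\<And>a b d. a \<in> U \<Longrightarrow> b \<in> U \<Longrightarrow> d \<in> U' \<Longrightarrow> X a + Y b + Z d = 0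
      \<Longrightarrow> a = 0 \<and> b = 0 \<and> d = 0"
    and dims: "has_dim (ker_pow D (Suc (Suc r)) U) p" "has_dim (ker_pow D r U) q"
      "has_dim (ker_pow D (Suc r) U') s"
  shows "has_dim (ker_pow D (Suc r) (X ` U + Y ` U + Z ` U')) (p + q + s)"
proof -
  note zero = lin[THEN linear_0] and add = lin[THEN linear_add] and scale = lin[THEN linear_scale]
    and neg = lin[THEN linear_neg] and diff = lin[THEN linear_diff]
  note pow = lin(1)[THEN linear_funpow]
  define c where "c = inverse (real (Suc r))"
  have c: "c * real (Suc r) = 1" "c \<noteq> 0"
    by (simp_all add: c_def)
  define P where "P a = X a - c *\<^sub>R Y (D a)" for a
  have linP: "linear P"
    unfolding P_def by (intro linearI) (simp_all add: add scale algebra_simps)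
  have powU: "(D ^^ t) u \<in> U" if "u \<in> U" for t u
    using that by (induction t) (auto simp: U)
  have powU': "(D ^^ t) u \<in> U'" if "u \<in> U'" for t u
    using that by (induction t) (auto simp: U')
  have powX: "(D ^^ t) (X u) = X ((D ^^ t) u)" if "u \<in> U" for t u
    using that by (induction t) (auto simp: DX powU)
  have powZ: "(D ^^ t) (Z u) = Z ((D ^^ t) u)" if "u \<in> U'" for t u
    using that by (induction t) (auto simp: DZ powU')
  \<comment> \<open>On \<open>U\<close> the commutator of \<open>D\<close> and \<open>Y\<close> is
    \<open>X\<close>, which commutes with \<open>D\<close>, so only one correction term
    arises.\<close>
  have powY: "(D ^^ Suc t) (Y u) = real (Suc t) *\<^sub>R X ((D ^^ t) u) + Y ((D ^^ Suc t) u)"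
    if u: "u \<in> U" for t u
  proof (induction t)
    case 0
    show ?case by (simp add: DY u)
  next
    case (Suc t)
    have "(D ^^ Suc (Suc t)) (Y u) = D ((D ^^ Suc t) (Y u))"
      by simp
    also have "\<dots> = real (Suc t) *\<^sub>R X ((D ^^ Suc t) u)
        + (X ((D ^^ Suc t) u) + Y ((D ^^ Suc (Suc t)) u))"
      unfolding Suc.IH using DX[OF powU[OF u, of t]] DY[OF powU[OF u, of "Suc t"]]
      by (simp only: add scale funpow.simps o_apply)
    also have "\<dots> = real (Suc (Suc t)) *\<^sub>R X ((D ^^ Suc t) u) + Y ((D ^^ Suc (Suc t)) u)"
      unfolding of_nat_Suc[of "Suc t"] scaleR_left_distrib by (simp add: add_ac)
    finally show ?case .
  qed
  have powP: "(D ^^ Suc r) (P a) = - (c *\<^sub>R Y ((D ^^ Suc (Suc r)) a))" if a: "a \<in> U" for a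
  proof -
    have "(D ^^ Suc r) (P a) = X ((D ^^ Suc r) a) - c *\<^sub>R (real (Suc r) *\<^sub>R X ((D ^^ r) (D a))
        + Y ((D ^^ Suc r) (D a)))"
      unfolding P_def linear_diff[OF pow] linear_scale[OF pow] powX[OF a] powY[OF U(2)[OF a]] ..
    also have "\<dots> = - (c *\<^sub>R Y ((D ^^ Suc (Suc r)) a))"
      using c(1) by (simp add: funpow_swap1 scaleR_add_right mult.commute del: of_nat_Suc)
    finally show ?thesis .
  qed
  \<comment> \<open>\<open>P a\<close> differs from \<open>X a\<close> by a value of
    \<open>Y\<close>, so independence carries over from \<open>direct\<close>.\<close>
  have PYZ: "P a + Y b + Z d = 0 \<Longrightarrow> a = 0 \<and> b = 0 \<and> d = 0"
    if "a \<in> U" "b \<in> U" "d \<in> U'" for a b d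
  proof -
    assume "P a + Y b + Z d = 0"
    then have "X a + Y (b - c *\<^sub>R D a) + Z d = 0"
      unfolding P_def by (simp add: diff scale algebra_simps)
    moreover have "b - c *\<^sub>R D a \<in> U"
      using that U by (intro subspace_diff subspace_scale) auto
    ultimately have "a = 0 \<and> b - c *\<^sub>R D a = 0 \<and> d = 0"
      using direct that by blast
    then show ?thesis
      by (auto simp: zero)
  qed
  \<comment> \<open>Rewriting \<open>X a + Y b\<close> as
    \<open>P a + Y (b + c *\<^sub>R D a)\<close> turns the coupled conditions on \<open>a\<close>
    and \<open>b\<close> into separate ones.\<close>
  have eq: "ker_pow D (Suc r) (X ` U + Y ` U + Z ` U')
    = P ` ker_pow D (Suc (Suc r)) U + Y ` ker_pow D r U + Z ` ker_pow D (Suc r) U'" (is "?L = ?R")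
  proof (intro set_eqI iffI)
    fix v assume "v \<in> ?L"
    then obtain a b d where abd: "a \<in> U" "b \<in> U" "d \<in> U'" and v: "v = X a + Y b + Z d"
      and v0: "(D ^^ Suc r) v = 0"
      by (auto simp: ker_pow_def set_plus_def)
    have "X ((D ^^ Suc r) a + real (Suc r) *\<^sub>R (D ^^ r) b) + Y ((D ^^ Suc r) b)
        + Z ((D ^^ Suc r) d) = (D ^^ Suc r) v"
      unfolding v linear_add[OF pow] powX[OF abd(1)] powY[OF abd(2)] powZ[OF abd(3)]
      by (simp only: add scale add.assoc)
    moreover have "(D ^^ Suc r) a + real (Suc r) *\<^sub>R (D ^^ r) b \<in> U"
      by (intro subspace_add subspace_scale U(1) powU abd)
    ultimately have rel: "(D ^^ Suc r) a + real (Suc r) *\<^sub>R (D ^^ r) b = 0"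
      "(D ^^ Suc r) b = 0" "(D ^^ Suc r) d = 0"
      using direct[of "(D ^^ Suc r) a + real (Suc r) *\<^sub>R (D ^^ r) b" "(D ^^ Suc r) b"
          "(D ^^ Suc r) d"] v0 powU abd powU' by metis+
    \<comment> \<open>Applying \<open>D\<close> eliminates \<open>b\<close> by the second relation
      and leaves the exponent \<open>r + 2\<close> on \<open>a\<close>.\<close>
    have "D ((D ^^ Suc r) a + real (Suc r) *\<^sub>R (D ^^ r) b) = 0"
      using rel(1) by (simp only: zero)
    moreover have "D ((D ^^ Suc r) a + real (Suc r) *\<^sub>R (D ^^ r) b)
      = (D ^^ Suc (Suc r)) a + real (Suc r) *\<^sub>R (D ^^ Suc r) b"
      by (simp only: add scale funpow.simps o_apply)
    ultimately have "(D ^^ Suc (Suc r)) a = 0"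
      using rel(2) by (metis add.right_neutral scaleR_zero_right)
    then have a: "a \<in> ker_pow D (Suc (Suc r)) U"
      using abd by (simp add: ker_pow_def)
    have "(D ^^ r) (b + c *\<^sub>R D a) = c *\<^sub>R ((D ^^ Suc r) a + real (Suc r) *\<^sub>R (D ^^ r) b)"
      using c(1) by (simp add: linear_add[OF pow] linear_scale[OF pow] funpow_swap1 scaleR_add_right
          del: of_nat_Suc)
    then have "(D ^^ r) (b + c *\<^sub>R D a) = 0"
      unfolding rel(1) by simp
    then have b: "b + c *\<^sub>R D a \<in> ker_pow D r U"
      using abd U by (simp add: ker_pow_def subspace_add subspace_scale)
    have "v = P a + Y (b + c *\<^sub>R D a) + Z d"
      by (simp add: v P_def add scale)
    moreover have "d \<in> ker_pow D (Suc r) U'"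
      using abd rel by (simp add: ker_pow_def)
    ultimately show "v \<in> ?R"
      using a b by (auto intro!: set_plus_intro)
  next
    fix v assume "v \<in> ?R"
    then obtain a b d where abd: "a \<in> U" "b \<in> U" "d \<in> U'" and v: "v = P a + Y b + Z d"
      and rel: "(D ^^ Suc (Suc r)) a = 0" "(D ^^ r) b = 0" "(D ^^ Suc r) d = 0"
      by (auto simp: ker_pow_def set_plus_def)
    have "(D ^^ Suc r) b = 0"
      using rel(2) by (simp add: zero)
    then have "(D ^^ Suc r) v = 0"
      unfolding v linear_add[OF pow] powP[OF abd(1)] powY[OF abd(2)] powZ[OF abd(3)] rel
      by (simp add: zero)
    moreover have "v = X a + Y (b - c *\<^sub>R D a) + Z d"
      by (simp add: v P_def diff scale)
    then have "v \<in> X ` U + Y ` U + Z ` U'"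
      using abd U by (auto intro!: set_plus_intro imageI subspace_diff subspace_scale)
    ultimately show "v \<in> ?L"
      by (simp add: ker_pow_def)
  qed
  have sub: "ker_pow D t U \<subseteq> U" "ker_pow D t U' \<subseteq> U'" for t
    by (auto simp: ker_pow_def)
  have sub0: "0 \<in> U" "0 \<in> U'"
    using U U' by (auto intro: subspace_0)
  have injs: "inj_on P (ker_pow D (Suc (Suc r)) U)" "inj_on Y (ker_pow D r U)"
    "inj_on Z (ker_pow D (Suc r) U')"
    unfolding linear_injective_on_subspace_0[OF linP has_dim_imp_subspace[OF dims(1)]]
      linear_injective_on_subspace_0[OF lin(3) has_dim_imp_subspace[OF dims(2)]]
      linear_injective_on_subspace_0[OF lin(4) has_dim_imp_subspace[OF dims(3)]]
  proof (safe)
    fix v assume "v \<in> ker_pow D (Suc (Suc r)) U" "P v = 0"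
    then show "v = 0"
      using PYZ[of v 0 0] sub sub0 by (auto simp: zero)
  next
    fix v assume "v \<in> ker_pow D r U" "Y v = 0"
    then show "v = 0"
      using PYZ[of 0 v 0] sub sub0 by (auto simp: zero linear_0[OF linP])
  next
    fix v assume "v \<in> ker_pow D (Suc r) U'" "Z v = 0"
    then show "v = 0"
      using PYZ[of 0 0 v] sub sub0 by (auto simp: zero linear_0[OF linP])
  qed
  have PY: "has_dim (P ` ker_pow D (Suc (Suc r)) U + Y ` ker_pow D r U) (p + q)"
  proof (intro has_dim_direct_sum has_dim_image linP lin injs dims subsetI)
    fix v assume "v \<in> P ` ker_pow D (Suc (Suc r)) U \<inter> Y ` ker_pow D r U"
    then obtain a b where ab: "a \<in> U" "b \<in> U" "v = P a" "v = Y b"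
      using sub by blast
    then have "P a + Y (- b) + Z 0 = 0"
      by (simp add: neg zero)
    then show "v \<in> {0}"
      using PYZ[of a "- b" 0] ab U(1) sub0 by (auto simp: subspace_neg zero)
  qed
  have "has_dim ?R (p + q + s)"
  proof (rule has_dim_direct_sum[OF PY has_dim_image[OF lin(4) injs(3) dims(3)]], rule subsetI)
    fix v assume "v \<in> (P ` ker_pow D (Suc (Suc r)) U + Y ` ker_pow D r U)
      \<inter> Z ` ker_pow D (Suc r) U'"
    then obtain a b d where abd: "a \<in> U" "b \<in> U" "d \<in> U'" "v = P a + Y b" "v = Z d"
      using sub by (fastforce simp: set_plus_def)
    then have "P a + Y b + Z (- d) = 0"
      by (simp add: neg)
    then show "v \<in> {0}"
      using PYZ[of a b "- d"] abd U'(1) by (auto simp: subspace_neg zero)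
  qed
  then show ?thesis
    unfolding eq .
qed

text \<open>
  \<open>tensor_ker_dim m r\<close> is the dimension of the kernel of the \<open>r\<close>-th power of the raising operator
  on the \<open>m\<close>-th tensor power of the two-dimensional representation of \<open>sl\<^sub>2\<close>.
\<close>

fun tensor_ker_dim :: "nat \<Rightarrow> nat \<Rightarrow> nat" where
  "tensor_ker_dim m 0 = 0"
| "tensor_ker_dim 0 (Suc r) = 1"
| "tensor_ker_dim (Suc m) (Suc r) = tensor_ker_dim m (Suc (Suc r)) + tensor_ker_dim m r"

section \<open>Closed form of the kernel dimensions\<close>

lemma binom_Suc: "binom (int (Suc m)) j = binom (int m) j + binom (int m) (j - 1)"
proof (cases "j \<le> 0")
  case True
  then show ?thesis by (auto simp: binom_def)
next
  case False
  then obtain i where "j = int (Suc i)"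
    by (metis not_le pos_int_cases Suc_pred)
  then show ?thesis by (simp add: binom_def nat_add_distrib)
qed

text \<open>An irreducible summand of dimension \<open>d\<close> contributes \<open>min d r\<close>
  to the kernel and has as many weights in a window of \<open>r\<close> consecutive weights around
  \<open>m / 2\<close>. By Pascal's rule the window sums obey the recursion.\<close>

lemma tensor_ker_dim_eq_sum:
  "tensor_ker_dim m r = (\<Sum>i<r. binom (int m) ((int m - int r + 1) div 2 + int i))"
proof (induction m r rule: tensor_ker_dim.induct)
  case (2 r)
  let ?s = "(- int r) div 2"
  have "(\<Sum>i<Suc r. binom 0 (?s + int i)) = (\<Sum>i<Suc r. if i = nat (- ?s) then 1 else 0)"
    by (rule sum.cong) (auto simp: binom_def)
  also have "\<dots> = 1"
    by (subst sum.delta) auto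
  finally show ?case by simp
next
  case (3 m r)
  define s where "s = (int m - int r + 1) div 2"
  have e: "(int m - int (Suc (Suc r)) + 1) div 2 = s - 1"
    "(int (Suc m) - int (Suc r) + 1) div 2 = s"
    "(int m - int r + 1) div 2 = s"
    by (simp_all add: s_def)
  have "(\<Sum>i<Suc r. binom (int (Suc m)) (s + int i))
      = (\<Sum>i<Suc r. binom (int m) (s + int i)) + (\<Sum>i<Suc r. binom (int m) (s - 1 + int i))"
    unfolding binom_Suc sum.distrib by (simp add: algebra_simps)
  \<comment> \<open>The top term of the first window moves to the second, so that the lengths become
    \<open>r\<close> and \<open>r + 2\<close>.\<close>
  also have "\<dots> = (\<Sum>i<Suc (Suc r). binom (int m) (s - 1 + int i)) + (\<Sum>i<r. binom (int m) (s + int i))"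
    by simp
  finally show ?case
    using 3 unfolding e by simp
qed simp

lemma tensor_ker_dim_1: "tensor_ker_dim m (Suc 0) = binom (int m) (int m div 2)"
  by (simp add: tensor_ker_dim_eq_sum)

section \<open>Elements with prescribed support\<close>

text \<open>These coordinate subspaces reduce linear algebra to set families: sums become unions,
  and multiplication by a fresh generator becomes insertion.\<close>

definition ext_on :: "'a set set \<Rightarrow> 'a ext set" where
  "ext_on F = {z. \<forall>S. coeff z S \<noteq> 0 \<longrightarrow> S \<in> F}"

lemma subspace_ext_on: "subspace (ext_on F)"
proof (rule subspaceI)
  fix x y :: "'a ext" assume xy: "x \<in> ext_on F" "y \<in> ext_on F"
  have "coeff x S \<noteq> 0 \<or> coeff y S \<noteq> 0" if "coeff (x + y) S \<noteq> 0" for S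
    using that by auto
  with xy show "x + y \<in> ext_on F"
    unfolding ext_on_def by blast
qed (auto simp: ext_on_def)

lemma ext_on_mono: "F \<subseteq> G \<Longrightarrow> ext_on F \<subseteq> ext_on G"
  by (auto simp: ext_on_def)

lemma ext_on_empty: "ext_on {} = {0}"
  by (auto simp: ext_on_def intro: ext_eqI)

lemma basis_in_ext_on: "S \<in> F \<Longrightarrow> basis_ext S \<in> ext_on F"
  by (auto simp: ext_on_def coeff_basis)

text \<open>Linear claims reduce to basis monomials by taking a kernel or a preimage for
  \<open>V\<close>.\<close>

lemma ext_on_subsetI:
  assumes "subspace V" "\<And>S. S \<in> F \<Longrightarrow> finite S \<Longrightarrow> basis_ext S \<in> V"
  shows "ext_on F \<subseteq> V"
proof
  fix z assume "z \<in> ext_on F"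
  then have "basis_ext S \<in> V" if "coeff z S \<noteq> 0" for S
    using that assms(2) coeff_infinite by (auto simp: ext_on_def)
  then have "(\<Sum>S | coeff z S \<noteq> 0. coeff z S *\<^sub>R basis_ext S) \<in> V"
    by (intro subspace_sum subspace_scale assms(1)) auto
  then show "z \<in> V"
    unfolding basis_expansion[of z, symmetric] .
qed

lemma subspace_set_plus: "subspace V \<Longrightarrow> subspace W \<Longrightarrow> subspace (V + W)"
  using real_vector.subspace_sums[of V W] by (auto simp: set_plus_def intro: back_subst[of subspace])

lemma ext_on_Un: "ext_on (F \<union> G) = ext_on F + ext_on G"
proof (rule antisym)
  show "ext_on (F \<union> G) \<subseteq> ext_on F + ext_on G"
  proof (rule ext_on_subsetI)
    show "subspace (ext_on F + ext_on G)"
      by (intro subspace_set_plus subspace_ext_on)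
    fix S assume "S \<in> F \<union> G"
    then have "basis_ext S + 0 \<in> ext_on F + ext_on G \<or> 0 + basis_ext S \<in> ext_on F + ext_on G"
      using subspace_0[OF subspace_ext_on] basis_in_ext_on set_plus_intro by blast
    then show "basis_ext S \<in> ext_on F + ext_on G"
      by simp
  qed
  show "ext_on F + ext_on G \<subseteq> ext_on (F \<union> G)"
    by (force simp: ext_on_def set_plus_def)
qed

lemma shuffle_sign_square: "shuffle_sign A B * shuffle_sign A B = 1"
  by (simp add: shuffle_sign_def)

lemma linear_gen_times: "linear ((*) (gen g))"
  by (rule linear_times)

text \<open>Since \<open>g\<close> is fresh, no product vanishes; the sign of moving
  \<open>g\<close> into place is absorbed into the scalars.\<close>

lemma ext_on_insert:
  assumes "\<And>S. S \<in> F \<Longrightarrow> g \<notin> S"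
  shows "ext_on (insert g ` F) = (*) (gen g) ` ext_on F"
proof (rule antisym)
  have basis: "gen g * basis_ext S = shuffle_sign {g} S *\<^sub>R basis_ext (insert g S)"
    if "S \<in> F" "finite S" for S
    using assms that by (simp add: gen_def basis_times_basis)
  show "ext_on (insert g ` F) \<subseteq> (*) (gen g) ` ext_on F"
  proof (rule ext_on_subsetI)
    show "subspace ((*) (gen g) ` ext_on F)"
      by (intro linear_subspace_image linear_gen_times subspace_ext_on)
    fix S assume S: "S \<in> insert g ` F" "finite S"
    then obtain T where T: "T \<in> F" "S = insert g T" "finite T"
      by auto
    have "basis_ext S = gen g * (shuffle_sign {g} T *\<^sub>R basis_ext T)"
      by (simp add: T basis shuffle_sign_square)
    moreover have "shuffle_sign {g} T *\<^sub>R basis_ext T \<in> ext_on F"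
      using T by (intro subspace_scale subspace_ext_on basis_in_ext_on)
    ultimately show "basis_ext S \<in> (*) (gen g) ` ext_on F"
      by blast
  qed
  have "ext_on F \<subseteq> (*) (gen g) -` ext_on (insert g ` F)"
  proof (rule ext_on_subsetI)
    show "subspace ((*) (gen g) -` ext_on (insert g ` F))"
      by (intro linear_subspace_vimage linear_gen_times subspace_ext_on)
    fix S assume "S \<in> F" "finite S"
    then show "basis_ext S \<in> (*) (gen g) -` ext_on (insert g ` F)"
      by (simp add: basis subspace_scale subspace_ext_on basis_in_ext_on)
  qed
  then show "(*) (gen g) ` ext_on F \<subseteq> ext_on (insert g ` F)"
    by blast
qed

text \<open>This is the interior product with the dual of \<open>g\<close>. Its sign undoes the one
  from left multiplication by \<open>g\<close>, which makes it a left inverse on elements free of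
  \<open>g\<close>.\<close>

lift_definition contract :: "'a::linorder \<Rightarrow> 'a ext \<Rightarrow> 'a ext" is
  "\<lambda>g f S. if g \<in> S then 0 else shuffle_sign {g} S * f (insert g S)"
  subgoal for g f
  proof (intro conjI allI impI)
    assume f: "finite {S. f S \<noteq> 0} \<and> (\<forall>S. infinite S \<longrightarrow> f S = 0)"
    have "{S. (if g \<in> S then 0 else shuffle_sign {g} S * f (insert g S)) \<noteq> 0}
        \<subseteq> (\<lambda>S. S - {g}) ` {S. f S \<noteq> 0}"
    proof
      fix S assume "S \<in> {S. (if g \<in> S then 0 else shuffle_sign {g} S * f (insert g S)) \<noteq> 0}"
      then show "S \<in> (\<lambda>S. S - {g}) ` {S. f S \<noteq> 0}"
        by (intro image_eqI[of _ _ "insert g S"]) (auto split: if_splits)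
    qed
    then show "finite {S. (if g \<in> S then 0 else shuffle_sign {g} S * f (insert g S)) \<noteq> 0}"
      by (rule finite_subset) (use f in auto)
  qed auto
  done

lemma linear_contract: "linear (contract g)"
  by (rule linearI; transfer; auto simp: fun_eq_iff algebra_simps)

lemma contract_gen_times:
  assumes "z \<in> ext_on F" "\<And>S. S \<in> F \<Longrightarrow> g \<notin> S"
  shows "contract g (gen g * z) = z"
proof -
  have "ext_on F \<subseteq> {z. contract g (gen g * z) = id z}"
  proof (rule ext_on_subsetI)
    show "subspace {z. contract g (gen g * z) = id z}"
      using linear_subspace_kernel[OF linear_compose_sub[OF
          linear_compose[OF linear_gen_times linear_contract] linear_id], of g g]
      by simp
    fix S assume "S \<in> F" "finite S"
    then have "g \<notin> S" "finite S"
      using assms(2) by auto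
    moreover have "coeff (contract g (basis_ext (insert g S))) T
        = (if T = S then shuffle_sign {g} S else 0)" if "g \<notin> S" "finite S" for T
      using that unfolding contract.rep_eq by (auto simp: coeff_basis)
    ultimately have "coeff (contract g (gen g * basis_ext S)) T = coeff (basis_ext S) T" for T
      by (simp add: gen_def basis_times_basis linear_scale[OF linear_contract] coeff_basis
          shuffle_sign_square)
    then show "basis_ext S \<in> {z. contract g (gen g * z) = id z}"
      by (auto intro: ext_eqI)
  qed
  then show ?thesis
    using assms(1) by auto
qed

lemma gen_times_eq_0_iff:
  assumes "z \<in> ext_on F" "\<And>S. S \<in> F \<Longrightarrow> g \<notin> S"
  shows "gen g * z = 0 \<longleftrightarrow> z = 0"
proof
  assume "gen g * z = 0"
  then show "z = 0"
    using contract_gen_times[OF assms] linear_0[OF linear_contract[of g]] by simp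
qed simp

lemma monomial_basis: "monomial gs = 0 \<or> distinct gs \<and> (\<exists>c. monomial gs = c *\<^sub>R basis_ext (set gs))"
proof (induction gs)
  case Nil
  show ?case by (auto simp: basis_empty intro: exI[of _ 1])
next
  case (Cons g gs)
  then show ?case
    by (auto simp: gen_def basis_times_basis)
qed

text \<open>Words with a repeated generator vanish, and sorting the others costs only a sign, so
  words can be replaced by sets.\<close>

lemma ess_cochains_eq_ext_on:
  "ess_cochains G k
    = ext_on {S. S \<subseteq> graph_gens G \<and> (\<Union>g\<in>S. gen_verts g) = verts G \<and> card S = k}"
  (is "_ = ext_on ?F")
  unfolding ess_cochains_eq
proof (rule antisym)
  let ?M = "{monomial gs | gs. set gs \<subseteq> graph_gens G \<and>
     (\<Union>g\<in>set gs. gen_verts g) = verts G \<and> length gs = k}"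
  show "span ?M \<subseteq> ext_on ?F"
  proof (rule span_minimal[OF _ subspace_ext_on], clarify)
    fix gs assume gs: "set gs \<subseteq> graph_gens G" "(\<Union>g\<in>set gs. gen_verts g) = verts G" "k = length gs"
    from monomial_basis[of gs] show "monomial gs \<in> ext_on
      {S. S \<subseteq> graph_gens G \<and> (\<Union>g\<in>S. gen_verts g) = verts G \<and> card S = length gs}"
    proof
      assume "distinct gs \<and> (\<exists>c. monomial gs = c *\<^sub>R basis_ext (set gs))"
      then show ?thesis
        using gs by (auto intro!: subspace_scale subspace_ext_on basis_in_ext_on simp: distinct_card)
    qed (simp add: subspace_0 subspace_ext_on)
  qed
  show "ext_on ?F \<subseteq> span ?M"
  proof (rule ext_on_subsetI)
    fix S assume "S \<in> ?F" "finite S"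
    then show "basis_ext S \<in> span ?M"
      unfolding basis_eq_monomial[OF \<open>finite S\<close>]
      by (intro span_base CollectI exI[of _ "sorted_list_of_set S"]) auto
  qed (rule subspace_span)
qed


section \<open>The star graph\<close>

text \<open>
  The monomials without the generator of the centre in which every leaf of \<open>star_graph n\<close> occurs.
  A leaf \<open>j\<close> contributes \<open>Vertex j\<close>, \<open>Edge 1 j\<close> or both, and \<open>a\<close> counts the leaves contributing
  both, so that the degree is \<open>n + a\<close>.
\<close>

fun leaf_covers :: "nat \<Rightarrow> nat \<Rightarrow> nat generator set set" where
  "leaf_covers 0 a = (if a = 0 then {{}} else {})"
| "leaf_covers (Suc n) a = insert (Vertex (n + 2)) ` leaf_covers n a
    \<union> insert (Edge 1 (n + 2)) ` leaf_covers n a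
    \<union> insert (Vertex (n + 2)) ` insert (Edge 1 (n + 2)) `
        (case a of 0 \<Rightarrow> {} | Suc b \<Rightarrow> leaf_covers n b)"

section \<open>Combinatorics of leaf covers\<close>

definition leaf_gens :: "nat \<Rightarrow> nat generator set" where
  "leaf_gens n = Vertex ` {2..n + 1} \<union> Edge 1 ` {2..n + 1}"

lemma finite_leaf_gens: "finite (leaf_gens n)"
  by (simp add: leaf_gens_def)

lemma leaf_gens_Suc:
  "leaf_gens (Suc n) = insert (Vertex (n + 2)) (insert (Edge 1 (n + 2)) (leaf_gens n))"
proof -
  have "{2..Suc n + 1} = insert (n + 2) {2..n + 1}"
    by auto
  then show ?thesis
    by (auto simp: leaf_gens_def)
qed

lemma not_in_leaf_gens:
  "Vertex 1 \<notin> leaf_gens n" "Vertex (n + 2) \<notin> leaf_gens n" "Edge 1 (n + 2) \<notin> leaf_gens n"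
  by (auto simp: leaf_gens_def)

text \<open>Sending each generator to the leaf it covers hits all leaves. The bound keeps the number
  of doubled leaves from becoming negative.\<close>

lemma card_leaf_cover_ge:
  assumes "finite S" "\<forall>j\<in>{2..n + 1}. Vertex j \<in> S \<or> Edge 1 j \<in> S"
  shows "n \<le> card S"
proof -
  let ?leaf = "\<lambda>g. case g of Vertex j \<Rightarrow> j | Edge i j \<Rightarrow> j"
  have "{2..n + 1} \<subseteq> ?leaf ` S"
    using assms(2) by force
  then have "card {2..n + 1} \<le> card (?leaf ` S)"
    using assms(1) by (intro card_mono) auto
  also have "\<dots> \<le> card S"
    using assms(1) by (rule card_image_le)
  finally show ?thesis by simp
qed

text \<open>Links the recursion by leaves, suited to induction, with the description by degree,
  suited to the cochains.\<close>

lemma mem_leaf_covers_iff: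
  "S \<in> leaf_covers n a \<longleftrightarrow>
    S \<subseteq> leaf_gens n \<and> (\<forall>j\<in>{2..n + 1}. Vertex j \<in> S \<or> Edge 1 j \<in> S) \<and> card S = n + a"
proof (induction n arbitrary: a S)
  case 0
  then show ?case
    by (auto simp: leaf_gens_def)
next
  case (Suc n)
  define x y where xy: "x = Vertex (n + 2)" "y = Edge 1 (n + 2)"
  let ?C = "\<lambda>n a S. S \<subseteq> leaf_gens n \<and> (\<forall>j\<in>{2..n + 1}. Vertex j \<in> S \<or> Edge 1 j \<in> S)
    \<and> card S = n + a"
  have new: "x \<noteq> y" "x \<notin> leaf_gens n" "y \<notin> leaf_gens n"
    unfolding xy using not_in_leaf_gens by auto
  have gens: "leaf_gens (Suc n) = insert x (insert y (leaf_gens n))"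
    unfolding xy by (rule leaf_gens_Suc)
  have range: "{2..Suc n + 1} = insert (n + 2) {2..n + 1}"
    by auto
  have old: "Vertex j \<noteq> x" "Edge 1 j \<noteq> y" "Vertex j \<noteq> y" "Edge 1 j \<noteq> x" if "j \<in> {2..n + 1}" for j
    using that by (auto simp: xy)
  have fin: "finite T" if "T \<subseteq> leaf_gens m" for T m
    using that finite_leaf_gens finite_subset by blast
  show ?case
  proof
    assume "S \<in> leaf_covers (Suc n) a"
    then consider T where "S = insert x T" "T \<in> leaf_covers n a"
      | T where "S = insert y T" "T \<in> leaf_covers n a"
      | T b where "S = insert x (insert y T)" "T \<in> leaf_covers n b" "a = Suc b"
      by (auto simp: xy split: nat.splits)
    then show "?C (Suc n) a S"
    proof cases
      case 1
      then have "x \<notin> T" "finite T"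
        using Suc new fin[of T n] by auto
      then show ?thesis
        using Suc 1 unfolding gens range by (auto simp: xy)
    next
      case 2
      then have "y \<notin> T" "finite T"
        using Suc new fin[of T n] by auto
      then show ?thesis
        using Suc 2 unfolding gens range by (auto simp: xy)
    next
      case 3
      then have "x \<notin> insert y T" "y \<notin> T" "finite T"
        using Suc new fin[of T n] by auto
      then show ?thesis
        using Suc 3 unfolding gens range by (auto simp: xy)
    qed
  next
    assume C: "?C (Suc n) a S"
    define T where "T = S - {x, y}"
    have T: "T \<subseteq> leaf_gens n" "\<forall>j\<in>{2..n + 1}. Vertex j \<in> T \<or> Edge 1 j \<in> T"
      using C old unfolding T_def gens range by auto
    have xyT: "x \<notin> T" "y \<notin> T" "x \<notin> insert y T" "finite T"
      using new T fin[of T n] by auto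
    have "x \<in> S \<or> y \<in> S"
      using C unfolding range xy by auto
    then consider "S = insert x T" | "S = insert y T" | "S = insert x (insert y T)"
      unfolding T_def by blast
    then show "S \<in> leaf_covers (Suc n) a"
    proof cases
      case 1
      then have "T \<in> leaf_covers n a"
        using Suc C T xyT by simp
      then show ?thesis
        using 1 by (simp add: xy)
    next
      case 2
      then have "T \<in> leaf_covers n a"
        using Suc C T xyT by simp
      then show ?thesis
        using 2 by (simp add: xy)
    next
      case 3
      then have "Suc (card T) = n + a"
        using C xyT by simp
      \<comment> \<open>This excludes \<open>a = 0\<close>, where the recursion has no summand with
        a doubled leaf.\<close>
      moreover have "n \<le> card T"
        using card_leaf_cover_ge[OF xyT(4) T(2)] .
      ultimately obtain b where "a = Suc b" "card T = n + b"
        by (metis Suc_le_mono le_Suc_ex add_Suc_right add_left_cancel add_Suc_shift)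
      then have "T \<in> leaf_covers n b"
        using Suc T by simp
      then show ?thesis
        using 3 \<open>a = Suc b\<close> by (simp add: xy)
    qed
  qed
qed

lemma leaf_covers_subset: "S \<in> leaf_covers n a \<Longrightarrow> S \<subseteq> leaf_gens n"
  by (simp add: mem_leaf_covers_iff)

lemma new_not_in_leaf_cover:
  assumes "S \<in> leaf_covers n a"
  shows "Vertex 1 \<notin> S" "Vertex (n + 2) \<notin> S" "Edge 1 (n + 2) \<notin> S"
  using leaf_covers_subset[OF assms] not_in_leaf_gens by blast+

text \<open>
  Truncation at \<open>a = 0\<close> is avoided by indexing the third summand with the possibly empty family.
\<close>

abbreviation pred_covers :: "nat \<Rightarrow> nat \<Rightarrow> nat generator set set" where
  "pred_covers n a \<equiv> case a of 0 \<Rightarrow> {} | Suc b \<Rightarrow> leaf_covers n b"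

lemma new_not_in_pred_cover:
  assumes "S \<in> pred_covers n a"
  shows "Vertex 1 \<notin> S" "Vertex (n + 2) \<notin> S" "Edge 1 (n + 2) \<notin> S"
  using assms by (auto dest: new_not_in_leaf_cover split: nat.splits)

text \<open>The new leaf brings a tensor factor spanned by \<open>x\<close>, \<open>y\<close> and
  \<open>x y\<close>. The sum has the shape required by \<open>has_dim_ker_pow_step\<close>, with
  the trivial part shifted by one index.\<close>

lemma ext_on_leaf_covers_Suc:
  "ext_on (leaf_covers (Suc n) a) = (*) (gen (Vertex (n + 2))) ` ext_on (leaf_covers n a)
    + (*) (gen (Edge 1 (n + 2))) ` ext_on (leaf_covers n a)
    + (\<lambda>d. gen (Vertex (n + 2)) * (gen (Edge 1 (n + 2)) * d)) ` ext_on (pred_covers n a)"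
proof -
  have "ext_on (insert (Vertex (n + 2)) ` insert (Edge 1 (n + 2)) ` pred_covers n a)
    = (*) (gen (Vertex (n + 2))) ` (*) (gen (Edge 1 (n + 2))) ` ext_on (pred_covers n a)"
    using new_not_in_pred_cover[of _ n a] by (subst ext_on_insert; (subst ext_on_insert)?; auto)
  then show ?thesis
    using new_not_in_leaf_cover[of _ n a] unfolding leaf_covers.simps ext_on_Un
    by (simp add: ext_on_insert image_image)
qed

text \<open>Multiplying the relation by \<open>y\<close> isolates \<open>x y p\<close> up to sign,
  and multiplying it by \<open>x\<close> isolates \<open>x y q\<close>; then only the term in
  \<open>d\<close> remains.\<close>

lemma leaf_direct:
  assumes "p \<in> ext_on (leaf_covers n a)" "q \<in> ext_on (leaf_covers n a)" "d \<in> ext_on (pred_covers n a)"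
    and 0: "gen (Vertex (n + 2)) * p + gen (Edge 1 (n + 2)) * q
      + gen (Vertex (n + 2)) * (gen (Edge 1 (n + 2)) * d) = 0"
  shows "p = 0 \<and> q = 0 \<and> d = 0"
proof -
  define x y where xy: "x = Vertex (n + 2)" "y = Edge 1 (n + 2)"
  note 0 = 0[folded xy]
  have xz: "gen x * z = 0 \<longleftrightarrow> z = 0" and yz: "gen y * z = 0 \<longleftrightarrow> z = 0"
    and xyz: "gen x * (gen y * z) = 0 \<longleftrightarrow> z = 0"
    if "z \<in> ext_on F" and F: "\<And>S. S \<in> F \<Longrightarrow> x \<notin> S \<and> y \<notin> S" for z F
  proof -
    show xz: "gen x * z = 0 \<longleftrightarrow> z = 0" and yz: "gen y * z = 0 \<longleftrightarrow> z = 0"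
      using gen_times_eq_0_iff[OF that(1)] F by blast+
    have "gen y * z \<in> ext_on (insert y ` F)"
      using ext_on_insert[of F y] F that(1) by blast
    moreover have "x \<notin> S" if "S \<in> insert y ` F" for S
      using that F by (auto simp: xy)
    ultimately show "gen x * (gen y * z) = 0 \<longleftrightarrow> z = 0"
      using gen_times_eq_0_iff yz by blast
  qed
  have new: "x \<notin> S \<and> y \<notin> S" if "S \<in> leaf_covers n a \<or> S \<in> pred_covers n a" for S
    using that new_not_in_leaf_cover new_not_in_pred_cover unfolding xy by blast
  have "gen x * (gen y * p) = - (gen y * (gen x * p + gen y * q + gen x * (gen y * d)))"
    by (simp add: distrib_left gen_square_left gen_anticommute_left[of y x])
  then have p: "p = 0"
    using 0 xyz[OF assms(1)] new by simp
  have "gen x * (gen y * q) = gen x * (gen x * p + gen y * q + gen x * (gen y * d))"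
    by (simp add: distrib_left gen_square_left)
  then have q: "q = 0"
    using 0 xyz[OF assms(2)] new by simp
  show ?thesis
    using 0 p q xyz[OF assms(3)] new by simp
qed

text \<open>
  On the span of the leaf covers, \<open>Q\<close> is left multiplication by the generator of the centre after
  this even derivation, which maps \<open>Edge 1 j\<close> to \<open>Vertex j\<close>.
\<close>

definition leaf_diff :: "nat generator ext \<Rightarrow> nat generator ext" where
  "leaf_diff = contract (Vertex 1) \<circ> Q"

lemma linear_leaf_diff: "linear leaf_diff"
  unfolding leaf_diff_def by (rule linear_compose[OF linear_Q linear_contract])

lemma Q_leaf_cover_factors:
  "w \<in> ext_on (leaf_covers n a) \<Longrightarrow> \<exists>u\<in>ext_on (leaf_covers n a). Q w = gen (Vertex 1) * u"
proof (induction n arbitrary: a w)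
  case 0
  have "ext_on (leaf_covers 0 a) \<subseteq> {w. Q w = 0}"
    by (rule ext_on_subsetI) (auto simp: linear_subspace_kernel[OF linear_Q] basis_empty split: if_splits)
  then have "Q w = gen (Vertex 1) * 0"
    using 0 by auto
  then show ?case
    using subspace_0[OF subspace_ext_on] by blast
next
  case (Suc n)
  define c x y where cxy: "c = gen (Vertex (1::nat))" "x = gen (Vertex (n + 2))"
    "y = gen (Edge 1 (n + 2))"
  from Suc.prems obtain p q d where pqd: "p \<in> ext_on (leaf_covers n a)"
    "q \<in> ext_on (leaf_covers n a)" "d \<in> ext_on (pred_covers n a)"
    and w: "w = x * p + y * q + x * (y * d)"
    unfolding ext_on_leaf_covers_Suc cxy by (auto simp: set_plus_def)
  obtain p' q' where pq': "p' \<in> ext_on (leaf_covers n a)" "Q p = c * p'"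
    "q' \<in> ext_on (leaf_covers n a)" "Q q = c * q'"
    using Suc.IH pqd(1,2) unfolding cxy by meson
  obtain d' where d': "d' \<in> ext_on (pred_covers n a)" "Q d = c * d'"
  proof (cases a)
    case 0
    then show ?thesis
      using that[of 0] pqd(3) by (simp add: ext_on_empty linear_0[OF linear_Q])
  next
    case (Suc b)
    then show ?thesis
      using that Suc.IH[of d b] pqd(3) unfolding cxy by auto
  qed
  have Qx: "Q (x * z) = - (x * Q z)" and Qy: "Q (y * z) = c * (x * z) - y * Q z"
    and xc: "x * (c * z) = - (c * (x * z))" and yc: "y * (c * z) = - (c * (y * z))"
    and xx: "x * (x * z) = 0" for z
    unfolding cxy Q_gen_times
    by (simp_all only: Q_gen.simps mult.assoc gen_square_left mult_zero_left diff_0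
        gen_anticommute_left[of "Vertex (n + 2)" "Vertex 1"]
        gen_anticommute_left[of "Edge 1 (n + 2)" "Vertex 1"])
  \<comment> \<open>The sign from \<open>Q\<close> passing a generator cancels the one from moving
    \<open>c\<close> to the front, so the induced derivation is even. The summand
    \<open>x * q\<close> comes from \<open>y\<close> being sent to \<open>x\<close>.\<close>
  have "Q w = c * (x * (p' + q) + y * q' + x * (y * d'))"
    unfolding w linear_add[OF linear_Q] Qx Qy pq'(2,4) d'(2)
    by (simp add: distrib_left right_diff_distrib xc yc xx)
  moreover have "x * (p' + q) + y * q' + x * (y * d') \<in> ext_on (leaf_covers (Suc n) a)"
    unfolding ext_on_leaf_covers_Suc cxy
    using pqd pq' d' by (intro set_plus_intro imageI subspace_add subspace_ext_on)
  ultimately show ?case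
    unfolding cxy by blast
qed

text \<open>Contraction inverts multiplication by the centre, so a factorisation of
  \<open>Q w\<close> with a factor free of the centre is unique.\<close>

lemma leaf_diff_eqI:
  assumes "Q w = gen (Vertex 1) * u" "u \<in> ext_on {S. Vertex 1 \<notin> S}"
  shows "leaf_diff w = u"
  using contract_gen_times[OF assms(2)] by (simp add: leaf_diff_def assms(1))

lemma ext_on_leaf_covers_subset: "ext_on (leaf_covers n a) \<subseteq> ext_on {S. Vertex 1 \<notin> S}"
  using new_not_in_leaf_cover by (intro ext_on_mono) blast

lemma ext_on_pred_covers_subset: "ext_on (pred_covers n a) \<subseteq> ext_on {S. Vertex 1 \<notin> S}"
  using new_not_in_pred_cover by (intro ext_on_mono) blast

lemma
  assumes "w \<in> ext_on (leaf_covers n a)"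
  shows Q_eq_leaf_diff: "Q w = gen (Vertex 1) * leaf_diff w"
    and leaf_diff_in: "leaf_diff w \<in> ext_on (leaf_covers n a)"
proof -
  obtain u where u: "u \<in> ext_on (leaf_covers n a)" "Q w = gen (Vertex 1) * u"
    using Q_leaf_cover_factors[OF assms] by blast
  moreover have "leaf_diff w = u"
    using leaf_diff_eqI[OF u(2)] u(1) ext_on_leaf_covers_subset by blast
  ultimately show "Q w = gen (Vertex 1) * leaf_diff w" "leaf_diff w \<in> ext_on (leaf_covers n a)"
    by simp_all
qed

lemma
  assumes "w \<in> ext_on (pred_covers n a)"
  shows Q_eq_leaf_diff_pred: "Q w = gen (Vertex 1) * leaf_diff w"
    and leaf_diff_in_pred: "leaf_diff w \<in> ext_on (pred_covers n a)"
proof -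
  show "Q w = gen (Vertex 1) * leaf_diff w"
  proof (cases a)
    case 0
    then show ?thesis
      using assms by (simp add: ext_on_empty linear_0[OF linear_Q] linear_0[OF linear_leaf_diff])
  next
    case (Suc b)
    then show ?thesis
      using assms Q_eq_leaf_diff by simp
  qed
  show "leaf_diff w \<in> ext_on (pred_covers n a)"
  proof (cases a)
    case 0
    then show ?thesis
      using assms by (simp add: ext_on_empty linear_0[OF linear_leaf_diff])
  next
    case (Suc b)
    then show ?thesis
      using assms leaf_diff_in by simp
  qed
qed

section \<open>The derivation on the factor of one leaf\<close>

lemma gen_times_in_ext_on_avoiding:
  assumes "z \<in> ext_on {S. g \<notin> S}" "h \<noteq> g"
  shows "gen h * z \<in> ext_on {S. g \<notin> S}"
proof -
  have "ext_on {S. g \<notin> S} \<subseteq> (*) (gen h) -` ext_on {S. g \<notin> S}"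
  proof (rule ext_on_subsetI)
    show "subspace ((*) (gen h) -` ext_on {S. g \<notin> S})"
      by (intro linear_subspace_vimage linear_gen_times subspace_ext_on)
    fix S assume "S \<in> {S. g \<notin> S}" "finite S"
    then show "basis_ext S \<in> (*) (gen h) -` ext_on {S. g \<notin> S}"
      using assms(2)
      by (simp add: gen_def basis_times_basis subspace_0 subspace_scale subspace_ext_on basis_in_ext_on)
  qed
  then show ?thesis
    using assms(1) by blast
qed

text \<open>Assuming a factorisation of \<open>Q u\<close>, rather than membership in a family of
  covers, lets the rule apply again to a product with an edge generator.\<close>

lemma leaf_diff_Vertex_times:
  assumes "Q u = gen (Vertex 1) * leaf_diff u" "leaf_diff u \<in> ext_on {S. Vertex 1 \<notin> S}" "j \<noteq> 1"
  shows "leaf_diff (gen (Vertex j) * u) = gen (Vertex j) * leaf_diff u"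
proof (rule leaf_diff_eqI)
  show "Q (gen (Vertex j) * u) = gen (Vertex 1) * (gen (Vertex j) * leaf_diff u)"
    unfolding Q_gen_times assms(1)
    by (simp only: Q_gen.simps mult_zero_left diff_0 gen_anticommute_left[of "Vertex j" "Vertex 1"]
        minus_minus)
  show "gen (Vertex j) * leaf_diff u \<in> ext_on {S. Vertex 1 \<notin> S}"
    using assms(2,3) by (intro gen_times_in_ext_on_avoiding) auto
qed

lemma
  assumes Qu: "Q u = gen (Vertex 1) * leaf_diff u"
    and u: "u \<in> ext_on {S. Vertex 1 \<notin> S}" "leaf_diff u \<in> ext_on {S. Vertex 1 \<notin> S}"
    and "j \<noteq> 1"
  shows leaf_diff_Edge_times:
      "leaf_diff (gen (Edge 1 j) * u) = gen (Vertex j) * u + gen (Edge 1 j) * leaf_diff u"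
    and leaf_diff_Vertex_Edge_times:
      "leaf_diff (gen (Vertex j) * (gen (Edge 1 j) * u))
        = gen (Vertex j) * (gen (Edge 1 j) * leaf_diff u)"
proof -
  have Q: "Q (gen (Edge 1 j) * u)
      = gen (Vertex 1) * (gen (Vertex j) * u + gen (Edge 1 j) * leaf_diff u)"
    unfolding Q_gen_times Qu
    by (simp only: Q_gen.simps gen_anticommute_left[of "Edge 1 j" "Vertex 1"] mult.assoc
        distrib_left diff_minus_eq_add)
  have mem: "gen (Vertex j) * u + gen (Edge 1 j) * leaf_diff u \<in> ext_on {S. Vertex 1 \<notin> S}"
    using u \<open>j \<noteq> 1\<close> by (intro subspace_add subspace_ext_on gen_times_in_ext_on_avoiding) auto
  show eq: "leaf_diff (gen (Edge 1 j) * u) = gen (Vertex j) * u + gen (Edge 1 j) * leaf_diff u"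
    using Q mem by (rule leaf_diff_eqI)
  have "leaf_diff (gen (Vertex j) * (gen (Edge 1 j) * u))
      = gen (Vertex j) * leaf_diff (gen (Edge 1 j) * u)"
    using Q mem \<open>j \<noteq> 1\<close> unfolding eq[symmetric] by (rule leaf_diff_Vertex_times)
  then show "leaf_diff (gen (Vertex j) * (gen (Edge 1 j) * u))
      = gen (Vertex j) * (gen (Edge 1 j) * leaf_diff u)"
    unfolding eq by (simp only: distrib_left gen_square_left add_0)
qed

text \<open>The binomial coefficient chooses the doubled leaves, each a trivial factor; the other
  \<open>n - a\<close> leaves form a tensor power of the two-dimensional representation.\<close>

lemma has_dim_ker_pow_leaf_diff:
  "has_dim (ker_pow leaf_diff r (ext_on (leaf_covers n a))) ((n choose a) * tensor_ker_dim (n - a) r)"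
proof (induction n arbitrary: a r)
  case 0
  show ?case
  proof (cases "a = 0 \<and> r \<noteq> 0")
    case True
    then obtain s where s: "r = Suc s" "a = 0"
      using not0_implies_Suc by blast
    have "ext_on {{}} = span {1 :: nat generator ext}"
    proof (rule antisym)
      show "ext_on {{}} \<subseteq> span {1 :: nat generator ext}"
        by (rule ext_on_subsetI[OF subspace_span]) (simp add: basis_empty span_base)
      show "span {1 :: nat generator ext} \<subseteq> ext_on {{}}"
        using basis_in_ext_on[of "{}" "{{}} :: nat generator set set"]
        by (intro span_minimal subspace_ext_on) (simp add: basis_empty)
    qed
    moreover have "leaf_diff 1 = 0"
      by (simp add: leaf_diff_def linear_0[OF linear_contract])
    then have "(leaf_diff ^^ r) v = 0" if "v \<in> span {1}" for v
      using that linear_funpow[OF linear_leaf_diff, of s] unfolding s(1) funpow_Suc_right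
      by (auto simp: span_singleton linear_scale[OF linear_leaf_diff] linear_0)
    ultimately have "ker_pow leaf_diff r (ext_on (leaf_covers 0 a)) = span {1}"
      by (auto simp: ker_pow_def s(2))
    then show ?thesis
      using s has_dim_span_singleton[of "1 :: nat generator ext"] by simp
  next
    case False
    have "ker_pow leaf_diff r (ext_on (leaf_covers 0 a)) = {0}"
    proof (cases "a = 0")
      case True
      then show ?thesis
        using False by (simp add: ker_pow_0 subspace_ext_on)
    next
      case False
      then show ?thesis
        using linear_0[OF linear_funpow[OF linear_leaf_diff]] by (auto simp: ker_pow_def ext_on_empty)
    qed
    then show ?thesis
      using False has_dim_zero by (cases a) auto
  qed
next
  case (Suc n)
  note IH = Suc.IH
  show ?case
  proof (cases r)
    case 0
    then show ?thesis
      using has_dim_zero by (simp add: ker_pow_0 subspace_ext_on)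
  next
    case r: (Suc s)
    \<comment> \<open>For \<open>a = 0\<close> no leaf is doubled, so the trivial part of the new
      factor contributes nothing.\<close>
    define t where "t = (case a of 0 \<Rightarrow> 0 | Suc b \<Rightarrow> (n choose b) * tensor_ker_dim (n - b) (Suc s))"
    have pred: "has_dim (ker_pow leaf_diff (Suc s) (ext_on (pred_covers n a))) t"
    proof (cases a)
      case 0
      have "ker_pow leaf_diff (Suc s) {0} = {0}"
        using linear_0[OF linear_funpow[OF linear_leaf_diff, of "Suc s"]]
        unfolding ker_pow_def by blast
      then show ?thesis
        using has_dim_zero by (simp add: 0 t_def ext_on_empty del: funpow.simps)
    next
      case (Suc b)
      then show ?thesis
        using IH[of "Suc s" b]
        by (simp add: t_def)
    qed
    have step: "has_dim (ker_pow leaf_diff (Suc s) (ext_on (leaf_covers (Suc n) a)))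
      ((n choose a) * tensor_ker_dim (n - a) (Suc (Suc s)) + (n choose a) * tensor_ker_dim (n - a) s + t)"
      unfolding ext_on_leaf_covers_Suc
    proof (rule has_dim_ker_pow_step[OF linear_leaf_diff linear_gen_times linear_gen_times _
          subspace_ext_on leaf_diff_in subspace_ext_on leaf_diff_in_pred])
      show "linear (\<lambda>d. gen (Vertex (n + 2)) * (gen (Edge 1 (n + 2)) * d))"
        using linear_compose[OF linear_gen_times linear_gen_times] by (simp only: o_def)
    next
      fix u assume u: "u \<in> ext_on (leaf_covers n a)"
      note facts = Q_eq_leaf_diff[OF u] u[THEN subsetD[OF ext_on_leaf_covers_subset]]
        leaf_diff_in[OF u, THEN subsetD[OF ext_on_leaf_covers_subset]]
      show "leaf_diff (gen (Vertex (n + 2)) * u) = gen (Vertex (n + 2)) * leaf_diff u"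
        by (rule leaf_diff_Vertex_times[OF facts(1,3)]) simp
      show "leaf_diff (gen (Edge 1 (n + 2)) * u)
        = gen (Vertex (n + 2)) * u + gen (Edge 1 (n + 2)) * leaf_diff u"
        by (rule leaf_diff_Edge_times[OF facts]) simp
    next
      fix d assume d: "d \<in> ext_on (pred_covers n a)"
      show "leaf_diff (gen (Vertex (n + 2)) * (gen (Edge 1 (n + 2)) * d))
        = gen (Vertex (n + 2)) * (gen (Edge 1 (n + 2)) * leaf_diff d)"
        by (rule leaf_diff_Vertex_Edge_times[OF Q_eq_leaf_diff_pred[OF d]
              d[THEN subsetD[OF ext_on_pred_covers_subset]]
              leaf_diff_in_pred[OF d, THEN subsetD[OF ext_on_pred_covers_subset]]]) simp
    qed (assumption | rule leaf_direct IH pred)+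
    have "(n choose a) * tensor_ker_dim (n - a) (Suc (Suc s))
        + (n choose a) * tensor_ker_dim (n - a) s + t
      = (Suc n choose a) * tensor_ker_dim (Suc n - a) (Suc s)"
    proof (cases a)
      case 0
      then show ?thesis by (simp add: t_def)
    next
      case (Suc b)
      show ?thesis
      \<comment> \<open>Below \<open>n\<close> the recursion of \<open>tensor_ker_dim\<close> and
        Pascal's rule apply. Otherwise \<open>n choose Suc b\<close> vanishes, which removes the
        terms with the truncated difference.\<close>
      proof (cases "b < n")
        case True
        then have "n - b = Suc (n - Suc b)" by simp
        then show ?thesis by (simp add: t_def Suc algebra_simps)
      next
        case False
        then show ?thesis by (simp add: t_def Suc)
      qed
    qed
    then show ?thesis
      using step unfolding r by (simp only:)
  qed
qed

lemma has_dim_exists: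
  assumes V: "subspace V" "V \<subseteq> span F" "finite F"
  shows "\<exists>d. has_dim V d"
proof -
  obtain B where B: "B \<subseteq> V" "independent B" "V \<subseteq> span B"
    by (rule real_vector.basis_exists)
  then have "finite B"
    using real_vector.independent_span_bound[OF V(3) B(2)] V(2) by blast
  moreover have "span B = V"
    using B V(1) by (intro antisym span_minimal)
  ultimately show ?thesis
    unfolding has_dim_def using B(2) by blast
qed

text \<open>Rank-nullity demands some finite dimension; its value cancels in
  \<open>betti_star\<close>.\<close>

lemma has_dim_ext_on_exists:
  assumes "finite F"
  shows "\<exists>d. has_dim (ext_on F) d"
proof (rule has_dim_exists[OF subspace_ext_on])
  show "ext_on F \<subseteq> span (basis_ext ` F)"
    by (rule ext_on_subsetI[OF subspace_span]) (simp add: span_base)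
  show "finite (basis_ext ` F)"
    using assms by simp
qed

lemma finite_leaf_covers: "finite (leaf_covers n a)"
  by (rule finite_subset[of _ "Pow (leaf_gens n)"]) (auto dest: leaf_covers_subset simp: finite_leaf_gens)

section \<open>Essential cochains of the star graph\<close>

lemma graph_gens_star: "graph_gens (star_graph n) = insert (Vertex 1) (leaf_gens n)"
proof -
  have "edge_pairs (star_graph n) = Pair 1 ` {2..n + 1}"
    by (auto simp: edge_pairs_def star_graph_def doubleton_eq_iff)
  moreover have "{1..n + 1} = insert 1 {2..n + 1}"
    by auto
  ultimately show ?thesis
    by (auto simp: graph_gens_def leaf_gens_def star_graph_def)
qed

definition star_covers :: "nat \<Rightarrow> nat \<Rightarrow> nat generator set set" where
  "star_covers n k = {S. S \<subseteq> graph_gens (star_graph n) \<and>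
    (\<Union>g\<in>S. gen_verts g) = verts (star_graph n) \<and> card S = k}"

text \<open>The centre is covered by its own generator and by every edge, so only sets of leaf
  vertices miss it.\<close>

lemma mem_star_covers_iff:
  "S \<in> star_covers n k \<longleftrightarrow> S \<subseteq> insert (Vertex 1) (leaf_gens n) \<and>
    (\<forall>j\<in>{2..n + 1}. Vertex j \<in> S \<or> Edge 1 j \<in> S) \<and> \<not> S \<subseteq> Vertex ` {2..n + 1} \<and> card S = k"
proof -
  have "(\<Union>g\<in>S. gen_verts g) = {1..n + 1} \<longleftrightarrow>
      (\<forall>j\<in>{2..n + 1}. Vertex j \<in> S \<or> Edge 1 j \<in> S) \<and> \<not> S \<subseteq> Vertex ` {2..n + 1}"
    if S: "S \<subseteq> insert (Vertex 1) (leaf_gens n)"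
  proof -
    have sub: "(\<Union>g\<in>S. gen_verts g) \<subseteq> {1..n + 1}"
      using S by (force simp: leaf_gens_def)
    have leaf: "j \<in> (\<Union>g\<in>S. gen_verts g) \<longleftrightarrow> Vertex j \<in> S \<or> Edge 1 j \<in> S"
      if "j \<in> {2..n + 1}" for j
      using S that by (force simp: leaf_gens_def)
    have center: "1 \<in> (\<Union>g\<in>S. gen_verts g) \<longleftrightarrow> \<not> S \<subseteq> Vertex ` {2..n + 1}"
      using S by (force simp: leaf_gens_def)
    have "{1..n + 1} = insert 1 {2..n + 1}"
      by auto
    then have "(\<Union>g\<in>S. gen_verts g) = {1..n + 1} \<longleftrightarrow> insert 1 {2..n + 1} \<subseteq> (\<Union>g\<in>S. gen_verts g)"
      using sub by auto
    also have "\<dots> \<longleftrightarrow> (\<forall>j\<in>{2..n + 1}. Vertex j \<in> S \<or> Edge 1 j \<in> S) \<and> \<not> S \<subseteq> Vertex ` {2..n + 1}"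
      using leaf center by blast
    finally show ?thesis .
  qed
  then show ?thesis
    unfolding star_covers_def graph_gens_star by (auto simp: star_graph_def)
qed

text \<open>The leaf vertices alone form a leaf cover that misses the centre.\<close>

lemma star_covers_decomp:
  "insert (Vertex 1) ` pred_covers n a \<union> leaf_covers n a
    = star_covers n (n + a) \<union> (if a = 0 then {Vertex ` {2..n + 1}} else {})" (is "?L = ?R")
proof (intro set_eqI iffI)
  have cardX: "card (Vertex ` {2..n + 1} :: nat generator set) = n"
    by (subst card_image) (auto simp: inj_on_def)
  {
    fix S assume "S \<in> ?L"
    then consider T b where "a = Suc b" "S = insert (Vertex 1) T" "T \<in> leaf_covers n b"
      | "S \<in> leaf_covers n a"
      by (auto split: nat.splits)
    then show "S \<in> ?R"
    proof cases
      case 1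
      have "finite T" "Vertex 1 \<notin> T"
        using leaf_covers_subset[OF 1(3)] finite_leaf_gens[of n] new_not_in_leaf_cover[OF 1(3)]
        by (auto intro: finite_subset)
      then have "S \<in> star_covers n (n + a)"
        using 1 unfolding mem_star_covers_iff mem_leaf_covers_iff by auto
      then show ?thesis by simp
    next
      case 2
      then have S: "S \<subseteq> leaf_gens n" "\<forall>j\<in>{2..n + 1}. Vertex j \<in> S \<or> Edge 1 j \<in> S" "card S = n + a"
        unfolding mem_leaf_covers_iff by auto
      show ?thesis
      proof (cases "S \<subseteq> Vertex ` {2..n + 1}")
        case True
        then have "S = Vertex ` {2..n + 1}"
          using S(2) by blast
        then show ?thesis
          using S(3) cardX by simp
      next
        case False
        then show ?thesis
          using S unfolding Un_iff mem_star_covers_iff by blast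
      qed
    qed
  }
  {
    fix S assume "S \<in> ?R"
    then consider "S \<in> star_covers n (n + a)" "Vertex 1 \<in> S" | "S \<in> star_covers n (n + a)" "Vertex 1 \<notin> S"
      | "S = Vertex ` {2..n + 1}" "a = 0"
      by (auto split: if_splits)
    then show "S \<in> ?L"
    proof cases
      case 1
      \<comment> \<open>Removing the centre lowers the degree by one, which leads to
        \<open>pred_covers\<close>.\<close>
      define T where "T = S - {Vertex 1}"
      have T: "T \<subseteq> leaf_gens n" "\<forall>j\<in>{2..n + 1}. Vertex j \<in> T \<or> Edge 1 j \<in> T"
        "S = insert (Vertex 1) T" "Vertex 1 \<notin> T"
        using 1 unfolding T_def mem_star_covers_iff by auto
      then have fin: "finite T"
        using finite_leaf_gens finite_subset by blast
      have "Suc (card T) = n + a"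
        using 1(1) T(3,4) fin unfolding mem_star_covers_iff by simp
      moreover have "n \<le> card T"
        using card_leaf_cover_ge[OF fin T(2)] .
      ultimately obtain b where "a = Suc b" "card T = n + b"
        by (metis Suc_le_mono le_Suc_ex add_Suc_right add_left_cancel add_Suc_shift)
      then show ?thesis
        using T unfolding Un_iff by (auto simp: mem_leaf_covers_iff)
    next
      case 2
      then show ?thesis
        unfolding Un_iff mem_star_covers_iff mem_leaf_covers_iff by blast
    next
      case 3
      then show ?thesis
        using cardX unfolding Un_iff mem_leaf_covers_iff by (auto simp: leaf_gens_def)
    qed
  }
qed

section \<open>Cocycles, coboundaries and Betti numbers\<close>

lemma Q_basis_vertices: "S \<subseteq> range Vertex \<Longrightarrow> finite S \<Longrightarrow> Q (basis_ext S) = 0"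
proof -
  assume S: "S \<subseteq> range Vertex" "finite S"
  have "Q_list gs = 0" if "set gs \<subseteq> range Vertex" for gs :: "'a generator list"
    using that by (induction gs) auto
  then show ?thesis
    using S by (simp add: Q_basis)
qed

lemma Q_center_times:
  assumes "u \<in> ext_on (pred_covers n a)"
  shows "Q (gen (Vertex 1) * u) = 0"
  unfolding Q_gen_times Q_eq_leaf_diff_pred[OF assms] by (simp only: Q_gen.simps gen_square_left) simp

text \<open>The monomial of all leaf vertices, exceptional in degree \<open>n\<close>, is added to
  the cochains instead of being removed from the leaf covers, so both sides are sums of coordinate
  subspaces.\<close>

lemma ess_cochains_star_decomp:
  "(*) (gen (Vertex 1)) ` ext_on (pred_covers n a) + ext_on (leaf_covers n a)
    = ess_cochains (star_graph n) (n + a) + ext_on (if a = 0 then {Vertex ` {2..n + 1}} else {})"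
proof -
  have "(*) (gen (Vertex 1)) ` ext_on (pred_covers n a) = ext_on (insert (Vertex 1) ` pred_covers n a)"
    using new_not_in_pred_cover by (intro ext_on_insert[symmetric])
  then show ?thesis
    using star_covers_decomp[of n a]
    by (simp only: ess_cochains_eq_ext_on star_covers_def ext_on_Un[symmetric])
qed

text \<open>Writing \<open>D\<close> for \<open>leaf_diff\<close>,
  \<open>Q (c u + w) = c (D w)\<close>. Multiplication by \<open>c\<close> is injective on elements
  free of the centre, so the condition is \<open>D w = 0\<close> with \<open>u\<close>
  arbitrary.\<close>

lemma ess_cocycles_star:
  "ess_cocycles (star_graph n) (n + Suc b) = (*) (gen (Vertex 1)) ` ext_on (leaf_covers n b)
    + ker_pow leaf_diff 1 (ext_on (leaf_covers n (Suc b)))" (is "?L = ?R")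
proof -
  let ?c = "gen (Vertex (1::nat))"
  have C: "ess_cochains (star_graph n) (n + Suc b)
    = (*) ?c ` ext_on (leaf_covers n b) + ext_on (leaf_covers n (Suc b))"
    using ess_cochains_star_decomp[of n "Suc b"] by (simp add: ext_on_empty flip: set_zero)
  have Q: "Q (?c * u + w) = ?c * leaf_diff w"
    if "u \<in> ext_on (leaf_covers n b)" "w \<in> ext_on (leaf_covers n (Suc b))" for u w
    using that Q_center_times[of u n "Suc b"] Q_eq_leaf_diff[of w]
    unfolding linear_add[OF linear_Q] by simp
  have "?c * leaf_diff w = 0 \<longleftrightarrow> leaf_diff w = 0" if "w \<in> ext_on (leaf_covers n (Suc b))" for w
    using gen_times_eq_0_iff[OF leaf_diff_in[OF that]] new_not_in_leaf_cover by blast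
  then have "z \<in> ?L \<longleftrightarrow> z \<in> ?R" for z
    unfolding ess_cocycles_def C using Q by (fastforce simp: set_plus_def ker_pow_def)
  then show ?thesis by blast
qed

text \<open>The monomial added in degree \<open>n\<close> is a product of vertex generators, hence
  killed by \<open>Q\<close>, so adding it does not change the image.\<close>

lemma ess_coboundaries_star:
  "ess_coboundaries (star_graph n) (n + Suc b)
    = (*) (gen (Vertex 1)) ` leaf_diff ` ext_on (leaf_covers n b)"
proof -
  let ?c = "gen (Vertex (1::nat))"
  let ?E = "ext_on (if b = 0 then {Vertex ` {2..n + 1}} else {})"
  have "?E \<subseteq> {z. Q z = 0}"
    by (rule ext_on_subsetI)
      (auto intro!: Q_basis_vertices simp: linear_subspace_kernel[OF linear_Q] split: if_splits)
  then have "Q z = 0" if "z \<in> ?E" for z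
    using that by blast
  moreover have "0 \<in> ?E"
    by (rule subspace_0[OF subspace_ext_on])
  ultimately have "Q ` (ess_cochains (star_graph n) (n + b) + ?E) = Q ` ess_cochains (star_graph n) (n + b)"
    by (force simp: set_plus_def linear_add[OF linear_Q] image_iff)
  also have "Q ` (ess_cochains (star_graph n) (n + b) + ?E)
      = Q ` ((*) ?c ` ext_on (pred_covers n b) + ext_on (leaf_covers n b))"
    by (simp only: ess_cochains_star_decomp)
  also have "\<dots> = (*) ?c ` leaf_diff ` ext_on (leaf_covers n b)"
  proof -
    have Q: "Q (?c * u + w) = ?c * leaf_diff w"
      if "u \<in> ext_on (pred_covers n b)" "w \<in> ext_on (leaf_covers n b)" for u w
      using that Q_center_times[of u n b] Q_eq_leaf_diff[of w]
      unfolding linear_add[OF linear_Q] by simp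
    have "0 \<in> ext_on (pred_covers n b)"
      by (rule subspace_0[OF subspace_ext_on])
    then show ?thesis
      using Q by (force simp: set_plus_def image_iff)
  qed
  finally show ?thesis
    by (simp add: ess_coboundaries_def)
qed

text \<open>Let \<open>d\<close> be the dimension of \<open>W\<close> in degree
  \<open>n + b\<close>. The coboundaries have dimension \<open>d\<close> minus that of the kernel
  there, and the cocycles contain a copy of this whole space, so \<open>d\<close> cancels and two
  kernels remain.\<close>

lemma betti_star:
  "betti (star_graph n) (n + Suc b)
    = (n choose Suc b) * tensor_ker_dim (n - Suc b) 1 + (n choose b) * tensor_ker_dim (n - b) 1"
proof -
  let ?c = "gen (Vertex (1::nat))"
  let ?W = "\<lambda>a. ext_on (leaf_covers n a)"
  let ?N = "\<lambda>a. (n choose a) * tensor_ker_dim (n - a) 1"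
  have ct: "contract (Vertex 1) (?c * z) = z" if "z \<in> ?W a" for z a
    using contract_gen_times[OF that] new_not_in_leaf_cover by blast
  have inj: "inj_on ((*) ?c) (?W a)" for a
    by (rule inj_on_inverseI) (rule ct)
  obtain d where d: "has_dim (?W b) d"
    using has_dim_ext_on_exists finite_leaf_covers by blast
  have "has_dim {v \<in> ?W b. leaf_diff v = 0} (?N b)"
    using has_dim_ker_pow_leaf_diff[of 1 n b] by (simp add: ker_pow_def)
  then obtain i where i: "has_dim (leaf_diff ` ?W b) i" "d = ?N b + i"
    using has_dim_rank_nullity[OF d linear_leaf_diff] by blast
  have "leaf_diff ` ?W b \<subseteq> ?W b"
    using leaf_diff_in by blast
  then have "has_dim ((*) ?c ` leaf_diff ` ?W b) i"
    using has_dim_image[OF linear_gen_times inj_on_subset[OF inj] i(1)] by blast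
  then have B: "dim (ess_coboundaries (star_graph n) (n + Suc b)) = i"
    unfolding ess_coboundaries_star by (rule has_dim_imp_dim)
  have "has_dim ((*) ?c ` ?W b + ker_pow leaf_diff 1 (?W (Suc b))) (d + ?N (Suc b))"
  proof (intro has_dim_direct_sum has_dim_image linear_gen_times inj d has_dim_ker_pow_leaf_diff subsetI)
    fix z assume "z \<in> (*) ?c ` ?W b \<inter> ker_pow leaf_diff 1 (?W (Suc b))"
    then obtain u where u: "z = ?c * u" "z \<in> ?W (Suc b)"
      by (auto simp: ker_pow_def)
    \<comment> \<open>Multiples of the centre are killed by it, whereas multiplication by the centre
      is injective on the leaf covers.\<close>
    have "?c * z = 0"
      unfolding u(1) by (rule gen_square_left)
    then show "z \<in> {0}"
      using ct[OF u(2)] linear_0[OF linear_contract[of "Vertex (1::nat)"]] by simp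
  qed
  then have Z: "dim (ess_cocycles (star_graph n) (n + Suc b)) = d + ?N (Suc b)"
    unfolding ess_cocycles_star by (rule has_dim_imp_dim)
  show ?thesis
    unfolding betti_eq_dim_diff[OF simple_star_graph] B Z i(2) by simp
qed

text \<open>Here \<open>a\<close> counts the doubled leaves. For \<open>a > n\<close> the convention
  on negative entries agrees with \<open>n choose a = 0\<close>.\<close>

lemma binom_times_binom:
  "binom (int n - int a) ((int n - int a) div 2) * binom (int n) (int n - int a)
    = (n choose a) * tensor_ker_dim (n - a) 1"
proof (cases "a \<le> n")
  case True
  then have eq: "int n - int a = int (n - a)"
    by simp
  have "binom (int n) (int (n - a)) = n choose a"
    unfolding binomial_symmetric[OF True] by (simp add: binom_def del: of_nat_diff)
  then show ?thesis
    unfolding eq One_nat_def tensor_ker_dim_1 by (simp only: mult.commute)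
next
  case False
  then show ?thesis
    by (simp add: binom_def)
qed

theorem proposition35:
  fixes n k :: nat
  assumes "k > n" and "n > 0"
  shows "betti (star_graph n) k =
      binom (2 * int n - int k) ((2 * int n - int k) div 2) * binom (int n) (2 * int n - int k)
    + binom (2 * int n - int k + 1) ((2 * int n - int k + 1) div 2)
        * binom (int n) (2 * int n - int k + 1)"
proof -
  obtain b where k: "k = n + Suc b"
    using assms(1) less_iff_Suc_add by auto
  \<comment> \<open>These numbers count the leaves that are not doubled, in degrees \<open>k\<close>
    and \<open>k - 1\<close> of \<open>W\<close>.\<close>
  have "2 * int n - int k = int n - int (Suc b)" "2 * int n - int k + 1 = int n - int b"
    by (simp_all add: k)
  then show ?thesis
    unfolding k betti_star by (simp only: binom_times_binom)
qed

end
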